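(* Let $p\in(1,\infty)$, let $V_0$ be the set of three vertices of the Sierpiński gasket $K$, and let $\rho_p$ and the $\mathcal{G}_{\mathrm{sym}}$-invariant $p$-resistance form $\mathcal{E}_p^{(0)}$ on $V_0$ with $\mathcal{R}_{\rho_p,1}(\mathcal{E}_p^{(0)})|_{V_0}=\mathcal{E}_p^{(0)}$ be as fixed in the context. Let $\tilde{\mathcal{E}}_p^{(0)}$ be a $p$-resistance form on $V_0$ with the property that $\mathcal{R}_{\rho_p,1}(\tilde{\mathcal{E}}_p^{(0)})\big|_{V_0}=\tilde{\mathcal{E}}_p^{(0)}$. Then $\tilde{\mathcal{E}}_p^{(0)}=c\,\mathcal{E}_p^{(0)}$ for some $c\in(0,\infty)$.
   Context: Notation: $\|x\|_{\ell^s}=(\sum_k|x_k|^s)^{1/s}$ for $s\in(0,\infty)$, $\|x\|_{\ell^\infty}=\max_k|x_k|$; $\mathbf 1_X$ is the constant function $1$ on $X$. $p$-resistance forms on finite sets. For a non-empty finite set $V$, a $p$-resistance form on $V$ is a functional $\mathcal{E}:\mathbb{R}^V\to[0,\infty)$ such that (i) $\mathcal{E}^{1/p}$ is a seminorm on $\mathbb{R}^V$ and $\{u:\mathcal{E}(u)=0\}=\mathbb{R}\mathbf 1_V$; (ii) if $q\in(0,p]$, $r\in[p,\infty]$, $m,n\in\mathbb{N}$ and $T=(T_1,\dots,T_n):\mathbb{R}^m\to\mathbb{R}^n$ satisfies $T(0)=0$ and $\|T(x)-T(y)\|_{\ell^r}\le\|x-y\|_{\ell^q}$ for all $x,y\in\mathbb{R}^m$,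 then for all $u=(u_1,\dots,u_m)\in(\mathbb{R}^V)^m$, $\|(\mathcal{E}(T_k(u))^{1/p})_{k=1}^n\|_{\ell^r}\le\|(\mathcal{E}(u_j)^{1/p})_{j=1}^m\|_{\ell^q}$. Trace: for $\emptyset\ne B\subset V$ and $u\in\mathbb{R}^B$, $\mathcal{E}|_B(u):=\inf\{\mathcal{E}(v)\mid v\in\mathbb{R}^V,\ v|_B=u\}$. Sierpiński gasket: $S=\{1,2,3\}$; $V_0=\{q_1,q_2,q_3\}\subset\mathbb{R}^2$ is the set of vertices of an equilateral triangle; $f_i(x)=q_i+\frac12(x-q_i)$; $K$ is the unique non-empty compact subset of $\mathbb{R}^2$ with $K=\bigcup_{i\in S}f_i(K)$, equipped with the Euclidean metric; $F_i:=f_i|_K$; $V_1:=\bigcup_{i\in S}F_i(V_0)\supset V_0$. $\mathcal{G}_{\mathrm{sym}}$ is the group of isometries of $K$ (each of them maps $V_0$ onto $V_0$). For a $p$-resistance form $\mathcal{E}$ on $V_0$ and $\rho\in(0,\infty)$, $\mathcal{R}_{\rho,1}(\mathcal{E})(u):=\sum_{i\in S}\rho\,\mathcal{E}(u\circ F_i|_{V_0})$ for $u\in\mathbb{R}^{V_1}$ (a $p$-resistance form on $V_1$). There exists a unique $\rho_p\in(0,\infty)$ such that $\mathcal{R}_{\rho_p,1}(\mathcal{E})|_{V_0}=\mathcal{E}$ for some $p$-resistance form $\mathcal{E}$ on $V_0$, and such $\mathcal{E}$ can be chosen $\mathcal{G}_{\mathrm{sym}}$-invariant, i.e. with $\mathcal{E}(u\circ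 g|_{V_0})=\mathcal{E}(u)$ for all $u\in\mathbb{R}^{V_0}$, $g\in\mathcal{G}_{\mathrm{sym}}$. $\mathcal{E}_p^{(0)}$ denotes a fixed such $\mathcal{G}_{\mathrm{sym}}$-invariant form. ($\tilde{\mathcal{E}}_p^{(0)}$ is not assumed to be $\mathcal{G}_{\mathrm{sym}}$-invariant.) *)

theory Defs
  imports "HOL-Analysis.Analysis"
begin

text \<open>Elements of the function space over \<open>V\<close> are represented by extensional functions
  (equal to \<open>undefined\<close> outside \<open>V\<close>), so that equality of functions on \<open>V\<close> is HOL equality.
  A functional on this space is a total HOL function of which only the values on
  \<open>rfun V\<close> are meaningful. Euclidean \<open>n\<close>-space is \<open>rfun {1..n}\<close>.\<close>

definition rfun :: "'a set \<Rightarrow> ('a \<Rightarrow> real) set" where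
  "rfun V = V \<rightarrow>\<^sub>E UNIV"

definition lnorm :: "ereal \<Rightarrow> 'i set \<Rightarrow> ('i \<Rightarrow> real) \<Rightarrow> real" where
  "lnorm s I x =
    (if s = \<infinity> then Max ((\<lambda>k. \<bar>x k\<bar>) ` I)
     else (\<Sum>k\<in>I. \<bar>x k\<bar> powr real_of_ereal s) powr (1 / real_of_ereal s))"

definition seminorm_on :: "'a set \<Rightarrow> (('a \<Rightarrow> real) \<Rightarrow> real) \<Rightarrow> bool" where
  "seminorm_on V N \<longleftrightarrow>
     (\<forall>u\<in>rfun V. 0 \<le> N u) \<and>
     (\<forall>u\<in>rfun V. \<forall>a::real. N (\<lambda>x\<in>V. a * u x) = \<bar>a\<bar> * N u) \<and>
     (\<forall>u\<in>rfun V. \<forall>v\<in>rfun V. N (\<lambda>x\<in>V. u x + v x) \<le> N u + N v)"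

definition contraction_property :: "real \<Rightarrow> 'a set \<Rightarrow> (('a \<Rightarrow> real) \<Rightarrow> real) \<Rightarrow> bool" where
  "contraction_property p V E \<longleftrightarrow>
     (\<forall>(q::real) (r::ereal) (m::nat) (n::nat) (T::(nat \<Rightarrow> real) \<Rightarrow> nat \<Rightarrow> real).
        0 < q \<longrightarrow> q \<le> p \<longrightarrow> ereal p \<le> r \<longrightarrow> 1 \<le> m \<longrightarrow> 1 \<le> n \<longrightarrow>
        T \<in> rfun {1..m} \<rightarrow> rfun {1..n} \<longrightarrow>
        T (\<lambda>j\<in>{1..m}. 0) = (\<lambda>k\<in>{1..n}. 0) \<longrightarrow>
        (\<forall>x\<in>rfun {1..m}. \<forall>y\<in>rfun {1..m}.
           lnorm r {1..n} (\<lambda>k. T x k - T y k) \<le> lnorm (ereal q) {1..m} (\<lambda>j. x j - y j)) \<longrightarrow>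
        (\<forall>u::nat \<Rightarrow> 'a \<Rightarrow> real. (\<forall>j\<in>{1..m}. u j \<in> rfun V) \<longrightarrow>
           lnorm r {1..n} (\<lambda>k. E (\<lambda>x\<in>V. T (\<lambda>j\<in>{1..m}. u j x) k) powr (1 / p))
           \<le> lnorm (ereal q) {1..m} (\<lambda>j. E (u j) powr (1 / p))))"

definition resistance_form :: "real \<Rightarrow> 'a set \<Rightarrow> (('a \<Rightarrow> real) \<Rightarrow> real) \<Rightarrow> bool" where
  "resistance_form p V E \<longleftrightarrow>
     finite V \<and> V \<noteq> {} \<and>
     (\<forall>u\<in>rfun V. 0 \<le> E u) \<and>
     seminorm_on V (\<lambda>u. E u powr (1 / p)) \<and>
     {u \<in> rfun V. E u = 0} = range (\<lambda>c::real. \<lambda>x\<in>V. c) \<and>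
     contraction_property p V E"

text \<open>The trace to \<open>B\<close> of a functional on \<open>rfun V\<close>, where \<open>B\<close> is a non-empty subset of \<open>V\<close>.\<close>

definition trace_form ::
  "'a set \<Rightarrow> 'a set \<Rightarrow> (('a \<Rightarrow> real) \<Rightarrow> real) \<Rightarrow> ('a \<Rightarrow> real) \<Rightarrow> real" where
  "trace_form V B E u = Inf {E v | v. v \<in> rfun V \<and> restrict v B = u}"

definition equilateral :: "(nat \<Rightarrow> real ^ 2) \<Rightarrow> bool" where
  "equilateral q \<longleftrightarrow>
     (\<exists>d>0. \<forall>i\<in>{1,2,3}. \<forall>j\<in>{1,2,3}. i \<noteq> j \<longrightarrow> dist (q i) (q j) = d)"

definition sg_map :: "(nat \<Rightarrow> real ^ 2) \<Rightarrow> nat \<Rightarrow> real ^ 2 \<Rightarrow> real ^ 2" where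
  "sg_map q i x = q i + (1 / 2) *\<^sub>R (x - q i)"

text \<open>By Hutchinson's theorem there is exactly one such \<open>K\<close>.\<close>

definition sierpinski_gasket :: "(nat \<Rightarrow> real ^ 2) \<Rightarrow> (real ^ 2) set \<Rightarrow> bool" where
  "sierpinski_gasket q K \<longleftrightarrow>
     K \<noteq> {} \<and> compact K \<and> K = (\<Union>i\<in>{1,2,3}. sg_map q i ` K)"

definition sg_V0 :: "(nat \<Rightarrow> real ^ 2) \<Rightarrow> (real ^ 2) set" where
  "sg_V0 q = q ` {1,2,3}"

definition sg_V1 :: "(nat \<Rightarrow> real ^ 2) \<Rightarrow> (real ^ 2) set" where
  "sg_V1 q = (\<Union>i\<in>{1,2,3}. sg_map q i ` sg_V0 q)"

text \<open>Surjectivity is part of being an isometry of \<open>K\<close>.\<close>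

definition isometries :: "'a::metric_space set \<Rightarrow> ('a \<Rightarrow> 'a) set" where
  "isometries K =
     {g \<in> K \<rightarrow>\<^sub>E K. g ` K = K \<and> (\<forall>x\<in>K. \<forall>y\<in>K. dist (g x) (g y) = dist x y)}"

definition sym_invariant ::
  "(nat \<Rightarrow> real ^ 2) \<Rightarrow> (real ^ 2) set \<Rightarrow> ((real ^ 2 \<Rightarrow> real) \<Rightarrow> real) \<Rightarrow> bool" where
  "sym_invariant q K E \<longleftrightarrow>
     (\<forall>u\<in>rfun (sg_V0 q). \<forall>g\<in>isometries K. E (restrict (u \<circ> g) (sg_V0 q)) = E u)"

definition renormalization ::
  "(nat \<Rightarrow> real ^ 2) \<Rightarrow> real \<Rightarrow> ((real ^ 2 \<Rightarrow> real) \<Rightarrow> real) \<Rightarrow> (real ^ 2 \<Rightarrow> real) \<Rightarrow> real" where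
  "renormalization q \<rho> E u =
     (\<Sum>i\<in>{1,2,3}. \<rho> * E (restrict (u \<circ> sg_map q i) (sg_V0 q)))"

definition eigenform ::
  "(nat \<Rightarrow> real ^ 2) \<Rightarrow> real \<Rightarrow> real \<Rightarrow> ((real ^ 2 \<Rightarrow> real) \<Rightarrow> real) \<Rightarrow> bool" where
  "eigenform q p \<rho> E \<longleftrightarrow>
     resistance_form p (sg_V0 q) E \<and>
     (\<forall>u\<in>rfun (sg_V0 q).
        trace_form (sg_V1 q) (sg_V0 q) (renormalization q \<rho> E) u = E u)"

end

theory Submission
  imports Defs
begin

text \<open>
  Let \<open>k\<close> be the maximum or the minimum of \<open>E' / E\<close> over non-constant functions on the three vertices
  and let \<open>C\<close> be the closed cone of all \<open>u\<close> with \<open>E' u = k * E u\<close>. Comparing energies of minimal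
  extensions shows that \<open>C\<close> is closed under replacing \<open>u\<close> by the restriction of its \<open>E\<close>-harmonic
  extension to any of the three cells. If \<open>u \<in> C\<close> has an extremum at a vertex, say
  \<open>u = (0, s, t)\<close> with \<open>s, t \<ge> 0\<close>, then passing to the cell at that vertex increases \<open>min s t / max s t\<close>
  strictly unless \<open>s = t\<close>. By compactness \<open>C\<close> contains \<open>(0, 1, 1)\<close>. Every non-constant function has an
  extremum at two vertices at least, so both cones contain two of the three functions
  \<open>(0, 1, 1), (1, 0, 1), (1, 1, 0)\<close> and hence share one. As \<open>E\<close> takes the same value on all three,
  the maximum and the minimum agree.

  The strict increase rests on three consequences of the contraction property for maps of the plane:
  submodularity (from \<open>(min, max)\<close>) gives comparison principles, and the Clarkson-type inequalities
  (from multiples of \<open>(x + y, x - y)\<close>) give strict convexity and differentiability, hence balance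
  equations for the partial derivatives at the midpoints. For large \<open>p\<close> or \<open>p < 2\<close> the usual Clarkson
  inequalities are replaced by cruder ones with easier proofs.
\<close>

section \<open>Two-point inequalities\<close>

lemma powr_above_tangent:
  fixes a x y :: real
  assumes "1 \<le> a" "0 \<le> x" "0 \<le> y"
  shows "y powr a + a * y powr (a - 1) * (x - y) \<le> x powr a"
proof (cases "y = 0")
  \<comment> \<open>All terms on the left vanish, even for \<open>a = 1\<close>, since
    \<open>0 powr 0 = 0\<close>.\<close>
  case True
  then show ?thesis by simp
next
  case False
  with assms have y: "0 < y" by simp
  show ?thesis
  proof (cases "x = 0")
    case True
    have "y powr a = y * y powr (a - 1)"
      using powr_mult_base[of y "a - 1"] y by simp
    moreover have "y * y powr (a - 1) \<le> a * (y * y powr (a - 1))"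
      using mult_right_mono[of 1 a "y * y powr (a - 1)"] assms y by simp
    ultimately show ?thesis
      using True by (simp add: algebra_simps)
  next
    case False
    with assms have x: "0 < x" by simp
    have "((\<lambda>x. x powr a) has_real_derivative a * y powr (a - 1)) (at y within {0<..})"
      using has_real_derivative_powr[OF y, of a] by (rule has_field_derivative_at_within)
    then have "x powr a - y powr a \<ge> (a * y powr (a - 1)) * (x - y)"
      using convex_on_imp_above_tangent[OF powr_convex[OF assms(1)], of y x] x y
      by (simp add: interior_open)
    then show ?thesis by simp
  qed
qed

text \<open>Averaging the tangent inequalities at the intermediate point \<open>z\<close> cancels
  the linear terms.\<close>

lemma powr_convex_nonneg:
  fixes a :: real
  assumes "1 \<le> a"
  shows "convex_on {0..} (\<lambda>x. x powr a)"
proof (rule convex_onI)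
  fix t x y :: real
  assume *: "0 < t" "t < 1" "x \<in> {0..}" "y \<in> {0..}"
  define z where "z = (1 - t) * x + t * y"
  have z: "0 \<le> z" using * by (simp add: z_def)
  have "(1 - t) * (z powr a + a * z powr (a - 1) * (x - z)) \<le> (1 - t) * x powr a"
    using * z assms by (intro mult_left_mono powr_above_tangent) auto
  moreover have "t * (z powr a + a * z powr (a - 1) * (y - z)) \<le> t * y powr a"
    using * z assms by (intro mult_left_mono powr_above_tangent) auto
  moreover have "(1 - t) * (z powr a + a * z powr (a - 1) * (x - z))
      + t * (z powr a + a * z powr (a - 1) * (y - z))
      = z powr a + a * z powr (a - 1) * ((1 - t) * x + t * y - z)"
    by (simp add: algebra_simps)
  ultimately have "z powr a \<le> (1 - t) * x powr a + t * y powr a"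
    by (simp add: z_def)
  then show "((1 - t) *\<^sub>R x + t *\<^sub>R y) powr a \<le> (1 - t) * x powr a + t * y powr a"
    by (simp add: z_def)
qed simp

lemma powr_midpoint_le:
  fixes a x y :: real
  assumes "1 \<le> a" "0 \<le> x" "0 \<le> y"
  shows "2 * ((x + y) / 2) powr a \<le> x powr a + y powr a"
  using convex_onD[OF powr_convex_nonneg[OF assms(1)], of "1/2" x y] assms
  by (simp add: add_divide_distrib)

text \<open>This is the convex case for the exponent \<open>1 / a\<close>, applied to the powers
  \<open>x powr a\<close> and \<open>y powr a\<close>. \<open>powr_add_le\<close> is obtained from
  \<open>powr_add_ge\<close> in the same way.\<close>

lemma powr_midpoint_ge:
  fixes a x y :: real
  assumes "0 < a" "a \<le> 1" "0 \<le> x" "0 \<le> y"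
  shows "x powr a + y powr a \<le> 2 * ((x + y) / 2) powr a"
proof -
  have "2 * ((x powr a + y powr a) / 2) powr (1 / a) \<le> x + y"
    using powr_midpoint_le[of "1 / a" "x powr a" "y powr a"] assms by (simp add: powr_powr)
  then have "(((x powr a + y powr a) / 2) powr (1 / a)) powr a \<le> ((x + y) / 2) powr a"
    using assms by (intro powr_mono2) auto
  then show ?thesis using assms by (simp add: powr_powr)
qed

text \<open>The fractions \<open>x / (x + y)\<close> and \<open>y / (x + y)\<close> add up to 1 and
  do not grow when raised to a power at least 1.\<close>

lemma powr_add_ge:
  fixes a x y :: real
  assumes "1 \<le> a" "0 \<le> x" "0 \<le> y"
  shows "x powr a + y powr a \<le> (x + y) powr a"
proof (cases "x + y = 0")
  case True
  then show ?thesis using assms by (simp add: add_nonneg_eq_0_iff)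
next
  case False
  then have s: "0 < x + y" using assms by simp
  have le: "u powr a \<le> u / (x + y) * (x + y) powr a" if "0 \<le> u" "u \<le> x + y" for u
  proof -
    have "(u / (x + y)) powr a \<le> (u / (x + y)) powr 1"
      using that s assms by (intro powr_mono') auto
    then show ?thesis
      using that s by (simp add: powr_divide divide_simps)
  qed
  have "x powr a + y powr a \<le> x / (x + y) * (x + y) powr a + y / (x + y) * (x + y) powr a"
    using assms by (intro add_mono le) auto
  also have "\<dots> = (x + y) / (x + y) * (x + y) powr a"
    by (simp only: add_divide_distrib distrib_right)
  also have "\<dots> = (x + y) powr a" using s by simp
  finally show ?thesis .
qed

lemma powr_add_le:
  fixes a x y :: real
  assumes "0 < a" "a \<le> 1" "0 \<le> x" "0 \<le> y"
  shows "(x + y) powr a \<le> x powr a + y powr a"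
proof -
  have "x + y \<le> (x powr a + y powr a) powr (1 / a)"
    using powr_add_ge[of "1 / a" "x powr a" "y powr a"] assms by (simp add: powr_powr)
  then have "(x + y) powr a \<le> ((x powr a + y powr a) powr (1 / a)) powr a"
    using assms by (intro powr_mono2) auto
  then show ?thesis using assms by (simp add: powr_powr)
qed

section \<open>Clarkson-type inequalities for two numbers\<close>

lemma abs_powr_eq_square_powr: "\<bar>x\<bar> powr p = (x\<^sup>2) powr (p / 2)" for x p :: real
proof -
  have "(x\<^sup>2) powr (p / 2) = (\<bar>x\<bar> powr 2) powr (p / 2)" by simp
  then show ?thesis by (simp add: powr_powr del: powr_numeral)
qed

text \<open>The parallelogram identity reduces this to superadditivity and convexity of the power
  \<open>p / 2\<close> of squares; for \<open>p \<le> 2\<close> both inequalities are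
  reversed.\<close>

lemma weak_Clarkson_ge:
  fixes p x y :: real
  assumes "2 \<le> p"
  shows "2 * (\<bar>x\<bar> powr p + \<bar>y\<bar> powr p) \<le> \<bar>x + y\<bar> powr p + \<bar>x - y\<bar> powr p"
proof -
  have eq: "((x + y)\<^sup>2 + (x - y)\<^sup>2) / 2 = x\<^sup>2 + y\<^sup>2"
    by (simp add: power2_eq_square algebra_simps)
  have "2 * (x\<^sup>2 powr (p / 2) + y\<^sup>2 powr (p / 2)) \<le> 2 * (x\<^sup>2 + y\<^sup>2) powr (p / 2)"
    using assms by (intro mult_left_mono powr_add_ge) auto
  also have "\<dots> \<le> (x + y)\<^sup>2 powr (p / 2) + (x - y)\<^sup>2 powr (p / 2)"
    using powr_midpoint_le[of "p / 2" "(x + y)\<^sup>2" "(x - y)\<^sup>2"] assms unfolding eq by simp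
  finally show ?thesis by (simp add: abs_powr_eq_square_powr)
qed

lemma weak_Clarkson_le:
  fixes p x y :: real
  assumes "0 < p" "p \<le> 2"
  shows "\<bar>x + y\<bar> powr p + \<bar>x - y\<bar> powr p \<le> 2 * (\<bar>x\<bar> powr p + \<bar>y\<bar> powr p)"
proof -
  have eq: "((x + y)\<^sup>2 + (x - y)\<^sup>2) / 2 = x\<^sup>2 + y\<^sup>2"
    by (simp add: power2_eq_square algebra_simps)
  have "(x + y)\<^sup>2 powr (p / 2) + (x - y)\<^sup>2 powr (p / 2) \<le> 2 * (x\<^sup>2 + y\<^sup>2) powr (p / 2)"
    using powr_midpoint_ge[of "p / 2" "(x + y)\<^sup>2" "(x - y)\<^sup>2"] assms unfolding eq by simp
  also have "\<dots> \<le> 2 * (x\<^sup>2 powr (p / 2) + y\<^sup>2 powr (p / 2))"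
    using assms by (intro mult_left_mono powr_add_le) auto
  finally show ?thesis by (simp add: abs_powr_eq_square_powr)
qed

text \<open>The difference \<open>h\<close> is convex and even, so its minimum is at 0, where it
  equals 2.\<close>

lemma powr_plus_minus_ge:
  fixes p s :: real
  assumes "1 < p" "p \<le> 2" "\<bar>s\<bar> \<le> 1"
  shows "2 + p * (p - 1) * s\<^sup>2 \<le> (1 + s) powr p + (1 - s) powr p"
proof -
  define h where "h = (\<lambda>s. (1 + s) powr p + (1 - s) powr p - p * (p - 1) * s\<^sup>2)"
  define h1 where "h1 = (\<lambda>s. p * (1 + s) powr (p - 1) - p * (1 - s) powr (p - 1) - 2 * p * (p - 1) * s)"
  define h2 where "h2 = (\<lambda>s. p * (p - 1) * ((1 + s) powr (p - 2) + (1 - s) powr (p - 2) - 2))"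
  have conv: "convex_on {-1<..<1} h"
  proof (rule f''_ge0_imp_convex[where f' = h1 and f'' = h2])
    fix s :: real assume s: "s \<in> {-1<..<1}"
    show "(h has_real_derivative h1 s) (at s)"
      unfolding h_def h1_def using s
      by (auto intro!: derivative_eq_intros simp: algebra_simps)
    show "(h1 has_real_derivative h2 s) (at s)"
      unfolding h2_def h1_def using s
      by (auto intro!: derivative_eq_intros simp: algebra_simps)
    \<comment> \<open>The product of the two powers in \<open>h2\<close> is at least 1, because
      their common exponent is not positive. \<open>A\<close> and \<open>B\<close> are their square
      roots, so AM-GM bounds the sum below by 2.\<close>
    define A B where "A = (1 + s) powr ((p - 2) / 2)" and "B = (1 - s) powr ((p - 2) / 2)"
    have "(1 + s) * (1 - s) \<le> 1" by (simp add: algebra_simps)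
    moreover have "0 < (1 + s) * (1 - s)" using s by simp
    ultimately have "1 powr ((p - 2) / 2) \<le> ((1 + s) * (1 - s)) powr ((p - 2) / 2)"
      using assms by (intro powr_mono2') auto
    then have "1 \<le> A * B" by (simp add: A_def B_def powr_mult)
    moreover have "(1 + s) powr (p - 2) = A\<^sup>2" "(1 - s) powr (p - 2) = B\<^sup>2"
      by (simp_all add: A_def B_def power2_eq_square flip: powr_add)
    moreover have "2 * (A * B) \<le> A\<^sup>2 + B\<^sup>2"
      using sum_squares_bound[of A B] by simp
    ultimately have "0 \<le> (1 + s) powr (p - 2) + (1 - s) powr (p - 2) - 2" by linarith
    then show "h2 s \<ge> 0" using assms by (simp add: h2_def)
  qed simp
  have open_case: "2 \<le> h s" if "\<bar>s\<bar> < 1" for s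
  proof -
    have "h ((1 - 1/2) *\<^sub>R s + (1/2) *\<^sub>R (-s)) \<le> (1 - 1/2) * h s + (1/2) * h (-s)"
      using that by (intro convex_onD[OF conv]) auto
    moreover have "h (-s) = h s" "h 0 = 2" by (simp_all add: h_def)
    ultimately show ?thesis by simp
  qed
  have "2 \<le> h s"
  proof (cases "\<bar>s\<bar> < 1")
    case False
    then have s: "\<bar>s\<bar> = 1" using assms by simp
    \<comment> \<open>Interior points tending to the endpoint \<open>s\<close>; the bound passes to
      the limit by continuity of \<open>h\<close>.\<close>
    define S where "S = (\<lambda>n. s * (1 - 1 / real (Suc n)))"
    have S: "\<bar>S n\<bar> \<le> 1" for n
      using s by (simp add: S_def abs_mult)
    have "S \<longlonglongrightarrow> s * (1 - 0)"
      unfolding S_def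
      using LIMSEQ_inverse_real_of_nat by (intro tendsto_intros) (simp add: inverse_eq_divide)
    then have lim: "S \<longlonglongrightarrow> s" by simp
    have "0 \<le> 1 + S n" "0 \<le> 1 - S n" for n using S[of n] by linarith+
    then have "(\<lambda>n. h (S n)) \<longlonglongrightarrow> h s"
      unfolding h_def using assms by (intro tendsto_intros tendsto_powr' lim) auto
    then show ?thesis
    proof (rule Lim_bounded2[rule_format, where N = 1])
      fix n :: nat
      have "\<bar>s * (1 - 1 / real (Suc n))\<bar> = 1 - 1 / real (Suc n)"
        using s by (simp add: abs_mult)
      then show "2 \<le> h (S n)" by (intro open_case) (simp add: S_def)
    qed
  qed (rule open_case)
  then show ?thesis by (simp add: h_def)
qed

text \<open>Strict convexity needs a two-point bound for just one outer exponent \<open>r\<close>.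
  For \<open>2 \<le> p\<close> take \<open>r = p\<close>; for smaller \<open>p\<close> the lower
  bound quadratic in the ratio of the two numbers suffices.\<close>

lemma exists_convexity_exponent:
  fixes p :: real
  assumes "1 < p"
  obtains r where "p \<le> r"
    "\<And>x y :: real. 2 * (\<bar>x\<bar> powr r + \<bar>y\<bar> powr r) powr (p / r) \<le> \<bar>x + y\<bar> powr p + \<bar>x - y\<bar> powr p"
proof (cases "2 \<le> p")
  case True
  show ?thesis
    using that[of p] weak_Clarkson_ge[OF True] assms by (simp add: powr_one)
next
  case False
  \<comment> \<open>Chosen so that \<open>r / p * (p * (p - 1) / 2) = 1\<close>: then Bernoulli's
    inequality with exponent \<open>r / p\<close> absorbs exactly the quadratic term of
    \<open>powr_plus_minus_ge\<close>.\<close>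
  define r where "r = 2 / (p - 1)"
  have r2: "2 \<le> r" using False assms by (simp add: r_def field_simps)
  have unit: "2 * (1 + \<bar>s\<bar> powr r) powr (p / r) \<le> \<bar>1 + s\<bar> powr p + \<bar>1 - s\<bar> powr p"
    if s: "\<bar>s\<bar> \<le> 1" for s :: real
  proof -
    define w where "w = p * (p - 1) / 2 * s\<^sup>2"
    have w: "0 \<le> w" using assms by (simp add: w_def)
    have "\<bar>s\<bar> powr r \<le> \<bar>s\<bar> powr 2" using r2 s by (intro powr_mono') auto
    also have "\<bar>s\<bar> powr 2 = s\<^sup>2" by simp
    also have "s\<^sup>2 = r / p * w"
      using assms by (simp add: w_def r_def)
    finally have "1 + \<bar>s\<bar> powr r \<le> 1 + r / p * w" by simp
    also have "\<dots> \<le> (1 + w) powr (r / p)"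
      using powr_above_tangent[of "r / p" "1 + w" 1] w r2 False assms by simp
    finally have "(1 + \<bar>s\<bar> powr r) powr (p / r) \<le> ((1 + w) powr (r / p)) powr (p / r)"
      using assms r2 by (intro powr_mono2) auto
    also have "\<dots> = 1 + w" using assms r2 w by (simp add: powr_powr)
    finally have "2 * (1 + \<bar>s\<bar> powr r) powr (p / r) \<le> 2 + p * (p - 1) * s\<^sup>2"
      by (simp add: w_def)
    also have "\<dots> \<le> (1 + s) powr p + (1 - s) powr p"
      using s False assms by (intro powr_plus_minus_ge) auto
    finally show ?thesis using s by simp
  qed
  have ordered: "2 * (\<bar>x\<bar> powr r + \<bar>y\<bar> powr r) powr (p / r) \<le> \<bar>x + y\<bar> powr p + \<bar>x - y\<bar> powr p"
    if "\<bar>y\<bar> \<le> \<bar>x\<bar>" for x y :: real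
  proof (cases "x = 0")
    case True
    then show ?thesis using that by simp
  next
    case False
    define s where "s = y / x"
    have y: "y = x * s" using False by (simp add: s_def)
    have s: "\<bar>s\<bar> \<le> 1" using that False by (simp add: s_def field_simps)
    have "2 * (\<bar>x\<bar> powr r + \<bar>y\<bar> powr r) powr (p / r) = 2 * (\<bar>x\<bar> powr r * (1 + \<bar>s\<bar> powr r)) powr (p / r)"
      by (simp add: y abs_mult powr_mult distrib_left)
    also have "\<dots> = \<bar>x\<bar> powr p * (2 * (1 + \<bar>s\<bar> powr r) powr (p / r))"
      using r2 by (simp add: powr_mult powr_powr)
    also have "\<dots> \<le> \<bar>x\<bar> powr p * (\<bar>1 + s\<bar> powr p + \<bar>1 - s\<bar> powr p)"
      using unit[OF s] by (intro mult_left_mono) auto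
    also have "\<dots> = (\<bar>x\<bar> * \<bar>1 + s\<bar>) powr p + (\<bar>x\<bar> * \<bar>1 - s\<bar>) powr p"
      by (simp add: powr_mult distrib_left)
    also have "\<dots> = \<bar>x + y\<bar> powr p + \<bar>x - y\<bar> powr p"
      by (simp add: y algebra_simps flip: abs_mult)
    finally show ?thesis .
  qed
  show ?thesis
  proof (rule that)
    show "p \<le> r" using r2 False by simp
    show "2 * (\<bar>x\<bar> powr r + \<bar>y\<bar> powr r) powr (p / r) \<le> \<bar>x + y\<bar> powr p + \<bar>x - y\<bar> powr p" for x y :: real
      using ordered[of y x] ordered[of x y]
      by (cases "\<bar>y\<bar> \<le> \<bar>x\<bar>") (auto simp: add.commute abs_minus_commute)
  qed
qed

text \<open>Odd powers cancel. Division by \<open>2 * k\<close> makes every coefficient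
  \<open>(2 * k choose i) / (2 * k) ^ i\<close> at most 1, hence at most
  \<open>k choose (i div 2)\<close>.\<close>

lemma even_power_plus_minus_le:
  fixes s :: real
  assumes "1 \<le> k"
  shows "(1 + s / (2 * real k)) ^ (2 * k) + (1 - s / (2 * real k)) ^ (2 * k) \<le> 2 * (1 + s\<^sup>2) ^ k"
proof -
  define t where "t = s / (2 * real k)"
  have "(1 + t) ^ (2 * k) + (1 - t) ^ (2 * k)
      = (\<Sum>i\<le>2 * k. of_nat (2 * k choose i) * t ^ i + of_nat (2 * k choose i) * (- t) ^ i)"
    using binomial_ring[of t 1 "2 * k"] binomial_ring[of "- t" 1 "2 * k"]
    by (simp add: sum.distrib add.commute)
  also have "\<dots> \<le> (\<Sum>i\<le>2 * k. if even i then 2 * (of_nat (k choose (i div 2)) * (s\<^sup>2) ^ (i div 2)) else 0)"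
  proof (rule sum_mono)
    fix i assume i: "i \<in> {..2 * k}"
    show "of_nat (2 * k choose i) * t ^ i + of_nat (2 * k choose i) * (- t) ^ i
        \<le> (if even i then 2 * (of_nat (k choose (i div 2)) * (s\<^sup>2) ^ (i div 2)) else 0)"
    proof (cases "even i")
      case True
      have "real (2 * k choose i) * t ^ i = real (2 * k choose i) / (2 * real k) ^ i * s ^ i"
        by (simp add: t_def power_divide)
      also have "\<dots> \<le> 1 * s ^ i"
      proof (intro mult_right_mono)
        have "2 * k choose i \<le> (2 * k) ^ i" using i by (intro binomial_le_pow) simp
        then have "real (2 * k choose i) \<le> real ((2 * k) ^ i)" by (simp only: of_nat_le_iff)
        then show "real (2 * k choose i) / (2 * real k) ^ i \<le> 1"
          using assms by (simp add: divide_simps)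
        show "0 \<le> s ^ i" using True by (simp add: zero_le_even_power)
      qed
      also have "\<dots> \<le> real (k choose (i div 2)) * s ^ i"
      proof (intro mult_right_mono)
        have "0 < k choose (i div 2)" using i by (simp add: zero_less_binomial_iff)
        then show "1 \<le> real (k choose (i div 2))" by linarith
        show "0 \<le> s ^ i" using True by (simp add: zero_le_even_power)
      qed
      also have "s ^ i = (s\<^sup>2) ^ (i div 2)" using True by (simp flip: power_mult)
      finally show ?thesis using True by (simp add: mult.commute)
    qed simp
  qed
  also have "\<dots> = (\<Sum>i\<in>{i. i \<le> 2 * k \<and> even i}. 2 * (of_nat (k choose (i div 2)) * (s\<^sup>2) ^ (i div 2)))"
    by (subst sum.inter_filter[symmetric]) (auto simp: atMost_def)
  also have "\<dots> = (\<Sum>j\<le>k. 2 * (of_nat (k choose j) * (s\<^sup>2) ^ j))"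
    by (rule sum.reindex_bij_witness[of _ "\<lambda>j. 2 * j" "\<lambda>i. i div 2"]) auto
  also have "\<dots> = 2 * (1 + s\<^sup>2) ^ k"
    using binomial_ring[of "s\<^sup>2" 1 k] by (simp add: sum_distrib_left add.commute)
  finally show ?thesis by (simp add: t_def)
qed

text \<open>The factor \<open>c\<close> is harmless, as the direction of differentiation can be
  rescaled. For \<open>2 < p\<close> it allows a comparison of power means with an even exponent
  \<open>2 * k\<close> at least \<open>p\<close>, which is treated by binomial expansion.\<close>

lemma exists_smoothness_exponent:
  fixes p :: real
  assumes "1 < p"
  obtains q c where "1 < q" "q \<le> p" "0 < c"
    "\<And>x y :: real. \<bar>x + c * y\<bar> powr p + \<bar>x - c * y\<bar> powr p \<le> 2 * (\<bar>x\<bar> powr q + \<bar>y\<bar> powr q) powr (p / q)"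
proof (cases "p \<le> 2")
  case True
  show ?thesis
    using that[of p 1] weak_Clarkson_le[OF _ True] assms by (simp add: powr_one)
next
  case False
  obtain k :: nat where k: "p \<le> 2 * real k"
    using real_arch_simple[of "p / 2"] by (auto simp: field_simps)
  then have k1: "1 \<le> k" using False by (cases k) auto
  define c where "c = 1 / (2 * real k)"
  have unit: "\<bar>1 + c * s\<bar> powr p + \<bar>1 - c * s\<bar> powr p \<le> 2 * (1 + s\<^sup>2) powr (p / 2)" for s
  proof -
    define a where "a = 2 * real k / p"
    have a: "1 \<le> a" using k False by (simp add: a_def)
    have pw: "(\<bar>z\<bar> powr p) powr a = z ^ (2 * k)" for z :: real
    proof -
      have "(\<bar>z\<bar> powr p) powr a = \<bar>z\<bar> powr real (2 * k)"
        using False by (simp add: powr_powr a_def)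
      also have "\<dots> = \<bar>z\<bar> ^ (2 * k)" using k1 by (intro powr_realpow') auto
      finally show ?thesis by (simp add: power_mult)
    qed
    have "2 * ((\<bar>1 + c * s\<bar> powr p + \<bar>1 - c * s\<bar> powr p) / 2) powr a
        \<le> (1 + c * s) ^ (2 * k) + (1 - c * s) ^ (2 * k)"
      using powr_midpoint_le[OF a, of "\<bar>1 + c * s\<bar> powr p" "\<bar>1 - c * s\<bar> powr p"] by (simp add: pw)
    also have "\<dots> \<le> 2 * (1 + s\<^sup>2) ^ k"
      using even_power_plus_minus_le[OF k1, of s] by (simp add: c_def)
    finally have "(((\<bar>1 + c * s\<bar> powr p + \<bar>1 - c * s\<bar> powr p) / 2) powr a) powr (1 / a)
        \<le> ((1 + s\<^sup>2) ^ k) powr (1 / a)"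
      using a by (intro powr_mono2) auto
    also have "(1 + s\<^sup>2) ^ k = (1 + s\<^sup>2) powr real k"
      by (rule powr_realpow[symmetric]) (simp add: add_pos_nonneg)
    also have "\<dots> powr (1 / a) = (1 + s\<^sup>2) powr (p / 2)"
      using k1 False by (simp add: powr_powr a_def)
    finally show ?thesis using a by (simp add: powr_powr)
  qed
  have "\<bar>x + c * y\<bar> powr p + \<bar>x - c * y\<bar> powr p \<le> 2 * (\<bar>x\<bar> powr 2 + \<bar>y\<bar> powr 2) powr (p / 2)"
    for x y :: real
  proof (cases "x = 0")
    case True
    have "\<bar>c * y\<bar> powr p \<le> \<bar>y\<bar> powr p"
      using k1 assms mult_right_mono[of c 1 "\<bar>y\<bar>"]
      by (intro powr_mono2) (auto simp: c_def abs_mult)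
    then show ?thesis using True by (simp add: powr_powr abs_powr_eq_square_powr)
  next
    case False
    define s where "s = y / x"
    have y: "y = x * s" using False by (simp add: s_def)
    have "\<bar>x + c * y\<bar> powr p + \<bar>x - c * y\<bar> powr p
        = (\<bar>x\<bar> * \<bar>1 + c * s\<bar>) powr p + (\<bar>x\<bar> * \<bar>1 - c * s\<bar>) powr p"
      by (simp add: y algebra_simps flip: abs_mult)
    also have "\<dots> = \<bar>x\<bar> powr p * (\<bar>1 + c * s\<bar> powr p + \<bar>1 - c * s\<bar> powr p)"
      by (simp add: powr_mult distrib_left)
    also have "\<dots> \<le> \<bar>x\<bar> powr p * (2 * (1 + s\<^sup>2) powr (p / 2))"
      by (intro mult_left_mono unit) simp
    also have "\<dots> = 2 * (x\<^sup>2 * (1 + s\<^sup>2)) powr (p / 2)"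
      by (simp add: powr_mult abs_powr_eq_square_powr)
    also have "x\<^sup>2 * (1 + s\<^sup>2) = \<bar>x\<bar> powr 2 + \<bar>y\<bar> powr 2"
      by (simp add: y power_mult_distrib distrib_left)
    finally show ?thesis .
  qed
  then show ?thesis
    using that[of 2 c] False k1 by (simp add: c_def)
qed

section \<open>Minimum and maximum as a contraction of the plane\<close>

lemma abs_powr_convex:
  fixes p :: real
  assumes "1 \<le> p"
  shows "convex_on UNIV (\<lambda>x. \<bar>x\<bar> powr p)"
proof (rule convex_onI)
  fix t x y :: real
  assume t: "0 < t" "t < 1"
  have "\<bar>(1 - t) * x + t * y\<bar> \<le> (1 - t) * \<bar>x\<bar> + t * \<bar>y\<bar>"
    using t abs_triangle_ineq[of "(1 - t) * x" "t * y"] by (simp add: abs_mult)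
  then have "\<bar>(1 - t) * x + t * y\<bar> powr p \<le> ((1 - t) * \<bar>x\<bar> + t * \<bar>y\<bar>) powr p"
    using assms by (intro powr_mono2) auto
  also have "\<dots> \<le> (1 - t) * \<bar>x\<bar> powr p + t * \<bar>y\<bar> powr p"
    using convex_onD[OF powr_convex_nonneg[OF assms], of t "\<bar>x\<bar>" "\<bar>y\<bar>"] t by simp
  finally show "\<bar>(1 - t) *\<^sub>R x + t *\<^sub>R y\<bar> powr p \<le> (1 - t) * \<bar>x\<bar> powr p + t * \<bar>y\<bar> powr p"
    by simp
qed simp

text \<open>The inner points \<open>C\<close> and \<open>D\<close> are convex combinations of
  \<open>A\<close> and \<open>B\<close> with exchanged weights, so adding the two convexity
  inequalities gives total weight 1 to each of \<open>f A\<close> and \<open>f B\<close>.\<close>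

lemma convex_on_exchange:
  fixes f :: "real \<Rightarrow> real"
  assumes "convex_on UNIV f" "A \<le> C" "C \<le> B" "A + B = C + D"
  shows "f C + f D \<le> f A + f B"
proof (cases "A = B")
  case True
  then show ?thesis using assms by auto
next
  case False
  then have AB: "A < B" using assms by auto
  define t where "t = (C - A) / (B - A)"
  have t: "0 \<le> t" "t \<le> 1" using AB assms by (auto simp: t_def)
  have tC: "t * (B - A) = C - A" using AB by (simp add: t_def)
  have C: "C = (1 - t) * A + t * B"
    using tC by (simp add: algebra_simps)
  have D: "D = (1 - t) * B + t * A"
    using tC assms(4) by (simp add: algebra_simps)
  have "f C \<le> (1 - t) * f A + t * f B" "f D \<le> (1 - t) * f B + t * f A"
    using convex_onD[OF assms(1), of t A B] convex_onD[OF assms(1), of t B A] t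
    by (simp_all add: C D)
  then have "f C + f D \<le> ((1 - t) * f A + t * f B) + ((1 - t) * f B + t * f A)" by linarith
  also have "\<dots> = f A + f B" by (simp add: algebra_simps)
  finally show ?thesis .
qed

text \<open>For pairs ordered alike the two terms are at most permuted. For pairs ordered oppositely
  the two differences keep their sum and move towards each other, so
  \<open>convex_on_exchange\<close> applies.\<close>

lemma min_max_powr_contraction:
  fixes p x y x' y' :: real
  assumes "1 \<le> p"
  shows "\<bar>min x y - min x' y'\<bar> powr p + \<bar>max x y - max x' y'\<bar> powr p
    \<le> \<bar>x - x'\<bar> powr p + \<bar>y - y'\<bar> powr p"
proof -
  note exch = convex_on_exchange[OF abs_powr_convex[OF assms]]
  consider "x \<le> y" "x' \<le> y'" | "y \<le> x" "y' \<le> x'" | "x \<le> y" "y' \<le> x'" | "y \<le> x" "x' \<le> y'"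
    by linarith
  then show ?thesis
  proof cases
    case 3
    then show ?thesis
      using exch[of "x - x'" "x - y'" "y - y'" "y - x'"] by (simp add: min_def max_def)
  next
    case 4
    then show ?thesis
      using exch[of "y - y'" "y - x'" "x - x'" "x - y'"] by (simp add: min_def max_def)
  qed (simp_all add: min_def max_def)
qed

section \<open>Strictly convex, smooth and submodular forms on three points\<close>

definition directional_deriv :: "('a::real_vector \<Rightarrow> real) \<Rightarrow> 'a \<Rightarrow> 'a \<Rightarrow> real" where
  "directional_deriv f x z = deriv (\<lambda>t. f (x + t *\<^sub>R z)) 0"

text \<open>The condition \<open>smooth\<close> on symmetric second differences is what the
  Clarkson-type bound yields directly; for a convex function it makes the one-sided derivatives
  agree.\<close>

locale smooth_convex =
  fixes f :: "'a::real_vector \<Rightarrow> real"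
  assumes convex: "convex_on UNIV f"
    and smooth: "((\<lambda>t. (f (x + t *\<^sub>R z) + f (x - t *\<^sub>R z) - 2 * f x) / t) \<longlongrightarrow> 0) (at 0)"
begin

text \<open>Convexity provides a support line with some slope \<open>k\<close>. The excess of
  \<open>g\<close> over it is nonnegative at \<open>t\<close> and at \<open>- t\<close>, and both
  excesses add up to the second difference, so each is negligible relative to
  \<open>t\<close>.\<close>

lemma directional_deriv_aux:
  "((\<lambda>t. f (x + t *\<^sub>R z)) has_real_derivative directional_deriv f x z) (at 0)
    \<and> (\<forall>t. f x + t * directional_deriv f x z \<le> f (x + t *\<^sub>R z))"
proof -
  define g where "g = (\<lambda>t. f (x + t *\<^sub>R z))"
  have "convex_on UNIV g"
  proof (rule convex_onI)
    fix t a b :: real assume t: "0 < t" "t < 1"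
    have "x + ((1 - t) *\<^sub>R a + t *\<^sub>R b) *\<^sub>R z
        = (1 - t) *\<^sub>R (x + a *\<^sub>R z) + t *\<^sub>R (x + b *\<^sub>R z)"
      by (simp add: algebra_simps)
    then show "g ((1 - t) *\<^sub>R a + t *\<^sub>R b) \<le> (1 - t) * g a + t * g b"
      using convex_onD[OF convex, of t "x + a *\<^sub>R z" "x + b *\<^sub>R z"] t by (simp add: g_def)
  qed simp
  then obtain k where k: "g 0 + k * t \<le> g t" for t
    using convex_le_Inf_differential[of UNIV g 0] by auto
  have "((\<lambda>t. (g t - g 0) / t - k) \<longlongrightarrow> 0) (at 0)"
  proof (rule Lim_null_comparison[OF _ tendsto_rabs_zero])
    show "((\<lambda>t. (g t + g (- t) - 2 * g 0) / t) \<longlongrightarrow> 0) (at 0)"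
      using smooth[of x z] by (simp add: g_def)
    have "\<bar>(g t - g 0) / t - k\<bar> \<le> \<bar>(g t + g (- t) - 2 * g 0) / t\<bar>" if "t \<noteq> 0" for t
    proof -
      have "(g t - g 0) / t - k = (g t - g 0 - k * t) / t"
        using that by (simp add: field_simps)
      moreover have "\<bar>g t - g 0 - k * t\<bar> \<le> \<bar>g t + g (- t) - 2 * g 0\<bar>"
        using k[of t] k[of "- t"] by simp
      ultimately show ?thesis by (simp add: divide_right_mono)
    qed
    then show "\<forall>\<^sub>F t in at 0. norm ((g t - g 0) / t - k) \<le> \<bar>(g t + g (- t) - 2 * g 0) / t\<bar>"
      by (auto simp: eventually_at_filter)
  qed
  then have "((\<lambda>t. (g t - g 0) / t) \<longlongrightarrow> k) (at 0)"
    by (simp add: LIM_zero_iff)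
  then have der: "(g has_real_derivative k) (at 0)"
    by (simp add: has_field_derivative_iff)
  then have "directional_deriv f x z = k"
    unfolding directional_deriv_def g_def[symmetric] by (rule DERIV_imp_deriv)
  with der k show ?thesis by (simp add: g_def mult.commute)
qed

lemmas has_directional_deriv = directional_deriv_aux[THEN conjunct1]

lemma subgradient: "f x + directional_deriv f x z \<le> f (x + z)"
  using directional_deriv_aux[of x z, THEN conjunct2, THEN spec, of 1] by simp

text \<open>The function minus the support line has a minimum at 0. Derivatives are computed below
  from such inequalities alone.\<close>

lemma directional_deriv_unique:
  assumes "\<And>t. f x + t * k \<le> f (x + t *\<^sub>R z)"
  shows "directional_deriv f x z = k"
proof -
  have "((\<lambda>t. f (x + t *\<^sub>R z) - t * k) has_real_derivative directional_deriv f x z - 1 * k) (at 0)"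
    by (intro DERIV_diff has_directional_deriv DERIV_cmult_right DERIV_ident)
  then have "directional_deriv f x z - 1 * k = 0"
    by (rule DERIV_local_min[of _ _ _ 1]) (use assms in \<open>simp_all add: le_diff_eq\<close>)
  then show ?thesis by simp
qed

lemma directional_deriv_scaleR: "directional_deriv f x (c *\<^sub>R z) = c * directional_deriv f x z"
proof (rule directional_deriv_unique)
  fix t
  show "f x + t * (c * directional_deriv f x z) \<le> f (x + t *\<^sub>R c *\<^sub>R z)"
    using directional_deriv_aux[of x z, THEN conjunct2, THEN spec, of "t * c"]
    by (simp add: mult.assoc)
qed

text \<open>The point \<open>x + t (z + w)\<close> is the midpoint of \<open>x + 2 t z\<close> and
  \<open>x + 2 t w\<close>, so convexity gives \<open>h\<close> its minimum at 0 and the derivative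
  of \<open>h\<close> vanishes there.\<close>

lemma directional_deriv_add:
  "directional_deriv f x (z + w) = directional_deriv f x z + directional_deriv f x w"
proof -
  define h where "h = (\<lambda>t. 1/2 * f (x + t *\<^sub>R (2 *\<^sub>R z)) + 1/2 * f (x + t *\<^sub>R (2 *\<^sub>R w)) - f (x + t *\<^sub>R (z + w)))"
  have "(h has_real_derivative 1/2 * directional_deriv f x (2 *\<^sub>R z)
      + 1/2 * directional_deriv f x (2 *\<^sub>R w) - directional_deriv f x (z + w)) (at 0)"
    unfolding h_def by (intro DERIV_diff DERIV_add DERIV_cmult has_directional_deriv)
  then have "1/2 * directional_deriv f x (2 *\<^sub>R z) + 1/2 * directional_deriv f x (2 *\<^sub>R w)
      - directional_deriv f x (z + w) = 0"
  proof (rule DERIV_local_min[of _ _ _ 1])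
    show "\<forall>t. \<bar>0 - t\<bar> < 1 \<longrightarrow> h 0 \<le> h t"
    proof (intro allI impI)
      fix t :: real
      have "(1 - 1/2) *\<^sub>R (x + t *\<^sub>R (2 *\<^sub>R z)) + (1/2) *\<^sub>R (x + t *\<^sub>R (2 *\<^sub>R w)) = x + t *\<^sub>R (z + w)"
        by (simp add: algebra_simps flip: scaleR_add_left)
      then show "h 0 \<le> h t"
        using convex_onD[OF convex, of "1/2" "x + t *\<^sub>R (2 *\<^sub>R z)" "x + t *\<^sub>R (2 *\<^sub>R w)"]
        by (simp add: h_def)
    qed
  qed simp
  then show ?thesis by (simp add: directional_deriv_scaleR)
qed

end

section \<open>Forms on three points and their partial derivatives\<close>

lemma abs_one_plus_powr_ge:
  fixes p t :: real
  assumes "1 \<le> p"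
  shows "1 + p * t \<le> \<bar>1 + t\<bar> powr p"
proof -
  have "1 + p * t \<le> 1 + p * (\<bar>1 + t\<bar> - 1)"
    using assms by (simp add: mult_left_mono)
  also have "\<dots> \<le> \<bar>1 + t\<bar> powr p"
    using powr_above_tangent[OF assms, of "\<bar>1 + t\<bar>" 1] by simp
  finally show ?thesis .
qed

text \<open>A function on three vertices is the triple of its values; the assumptions collect the
  consequences of the axioms of a p-resistance form on which the argument rests.\<close>

locale triangle_form =
  fixes p :: real and e :: "real \<times> real \<times> real \<Rightarrow> real"
  assumes p_gt_1: "1 < p"
    and nonneg: "0 \<le> e u"
    and scale: "e (t *\<^sub>R u) = \<bar>t\<bar> powr p * e u"
    and shift: "e (a + t, b + t, c + t) = e (a, b, c)"
    and zero_imp: "e (a, b, c) = 0 \<Longrightarrow> a = b \<and> b = c"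
    and convex_form: "convex_on UNIV e"
    and strictly_convex: "e (u - v) \<noteq> 0 \<Longrightarrow> 2 * e ((1/2) *\<^sub>R (u + v)) < e u + e v"
    and smooth_form:
      "((\<lambda>t. (e (u + t *\<^sub>R v) + e (u - t *\<^sub>R v) - 2 * e u) / t) \<longlongrightarrow> 0) (at 0)"
    and submodular:
      "e (min a a', min b b', min c c') + e (max a a', max b b', max c c')
        \<le> e (a, b, c) + e (a', b', c')"
begin

sublocale smooth_convex e
  using convex_form smooth_form by unfold_locales

lemma continuous: "continuous_on S e"
  using convex_on_continuous[OF open_UNIV convex_form] continuous_on_subset by blast

lemma scale3: "e (t * a, t * b, t * c) = \<bar>t\<bar> powr p * e (a, b, c)"
  using scale[of t "(a, b, c)"] by simp

lemma const_eq_0 [simp]: "e (t, t, t) = 0"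
  using shift[of 0 t 0 0] scale[of 0 0] by (simp add: zero_prod_def)

lemma eq_0_iff: "e (a, b, c) = 0 \<longleftrightarrow> a = b \<and> b = c"
  by (auto dest: zero_imp)

lemma pos_iff: "0 < e (a, b, c) \<longleftrightarrow> a \<noteq> b \<or> b \<noteq> c"
  using nonneg[of "(a, b, c)"] eq_0_iff[of a b c] by linarith

lemma midpoint_le: "2 * e ((1/2) *\<^sub>R (u + v)) \<le> e u + e v"
  using convex_onD[OF convex_form, of "1/2" u v] by (simp add: scaleR_add_right)

lemma midpoint_le3:
  "2 * e ((a + a') / 2, (b + b') / 2, (c + c') / 2) \<le> e (a, b, c) + e (a', b', c')"
  using midpoint_le[of "(a, b, c)" "(a', b', c')"] by simp

lemma strictly_convex3:
  "\<not> (a - a' = b - b' \<and> b - b' = c - c') \<Longrightarrow>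
    2 * e ((a + a') / 2, (b + b') / 2, (c + c') / 2) < e (a, b, c) + e (a', b', c')"
  using strictly_convex[of "(a, b, c)" "(a', b', c')"] eq_0_iff[of "a - a'" "b - b'" "c - c'"] by auto

lemma max_const_le: "e (max t a, max t b, max t c) \<le> e (a, b, c)"
  using submodular[of t a t b t c] nonneg[of "(min t a, min t b, min t c)"] by simp

lemma min_const_le: "e (min t a, min t b, min t c) \<le> e (a, b, c)"
  using submodular[of t a t b t c] nonneg[of "(max t a, max t b, max t c)"] by simp

text \<open>Electrically, \<open>d1\<close>, \<open>d2\<close> and \<open>d3\<close> are the
  currents at the three vertices up to a constant factor.\<close>

definition d1 where "d1 a b c = directional_deriv e (a, b, c) (1, 0, 0)"
definition d2 where "d2 a b c = directional_deriv e (a, b, c) (0, 1, 0)"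
definition d3 where "d3 a b c = directional_deriv e (a, b, c) (0, 0, 1)"

lemma directional_deriv_coords:
  "directional_deriv e (a, b, c) (r, s, t) = r * d1 a b c + s * d2 a b c + t * d3 a b c"
proof -
  have "(r, s, t) = r *\<^sub>R (1, 0, 0) + s *\<^sub>R (0, 1, 0) + t *\<^sub>R (0, 0, 1::real)"
    by simp
  then show ?thesis
    by (simp only: directional_deriv_add directional_deriv_scaleR d1_def d2_def d3_def)
qed

text \<open>Along the direction of \<open>(a, b, c)\<close> itself the form is multiplied by
  \<open>\<bar>1 + t\<bar> powr p\<close>, which lies above its tangent
  \<open>1 + p * t\<close>.\<close>

lemma Euler_identity: "a * d1 a b c + b * d2 a b c + c * d3 a b c = p * e (a, b, c)"
proof -
  have "directional_deriv e (a, b, c) (a, b, c) = p * e (a, b, c)"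
  proof (rule directional_deriv_unique)
    fix t
    have "e ((a, b, c) + t *\<^sub>R (a, b, c)) = \<bar>1 + t\<bar> powr p * e (a, b, c)"
      using scale[of "1 + t" "(a, b, c)"] by (simp add: algebra_simps)
    moreover have "(1 + p * t) * e (a, b, c) \<le> \<bar>1 + t\<bar> powr p * e (a, b, c)"
      using p_gt_1 by (intro mult_right_mono abs_one_plus_powr_ge nonneg) auto
    ultimately show "e (a, b, c) + t * (p * e (a, b, c)) \<le> e ((a, b, c) + t *\<^sub>R (a, b, c))"
      by (simp add: algebra_simps)
  qed
  then show ?thesis by (simp add: directional_deriv_coords)
qed

lemma deriv_sum_eq_0: "d1 a b c + d2 a b c + d3 a b c = 0"
proof -
  have "directional_deriv e (a, b, c) (1, 1, 1) = 0"
    by (rule directional_deriv_unique) (simp add: shift)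
  then show ?thesis by (simp add: directional_deriv_coords)
qed

lemma d1_subgradient: "e (a, b, c) + t * d1 a b c \<le> e (a + t, b, c)"
  using subgradient[of "(a, b, c)" "(t, 0, 0)"] by (simp add: directional_deriv_coords)

lemma d1_unique: "(\<And>t. e (a, b, c) + t * k \<le> e (a + t, b, c)) \<Longrightarrow> d1 a b c = k"
  unfolding d1_def by (rule directional_deriv_unique) simp

lemma d1_shift: "d1 (a + s) (b + s) (c + s) = d1 a b c"
proof (rule d1_unique)
  fix t
  have "e (a + s + t, b + s, c + s) = e (a + t, b, c)"
    using shift[of "a + t" s b c] by (simp add: add.commute add.left_commute)
  then show "e (a + s, b + s, c + s) + t * d1 a b c \<le> e (a + s + t, b + s, c + s)"
    using d1_subgradient[of a b c t] shift[of a s b c] by simp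
qed

lemma d1_const_eq_0 [simp]: "d1 t t t = 0"
  by (rule d1_unique) (simp add: nonneg)

lemma d1_scale:
  assumes "0 < s"
  shows "d1 (s * a) (s * b) (s * c) = s powr (p - 1) * d1 a b c"
proof (rule d1_unique)
  fix t
  have "e (s * a + t, s * b, s * c) = s powr p * e (a + t / s, b, c)"
    using scale3[of s "a + t / s" b c] assms by (simp add: distrib_left)
  moreover have "s powr p * (e (a, b, c) + t / s * d1 a b c) \<le> s powr p * e (a + t / s, b, c)"
    by (intro mult_left_mono d1_subgradient) simp
  moreover have "s powr p = s * s powr (p - 1)"
    using powr_mult_base[of s "p - 1"] assms by simp
  moreover have "e (s * a, s * b, s * c) = s powr p * e (a, b, c)"
    using scale3[of s a b c] assms by simp
  ultimately show "e (s * a, s * b, s * c) + t * (s powr (p - 1) * d1 a b c) \<le> e (s * a + t, s * b, s * c)"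
    using assms by (simp add: distrib_left mult_ac)
qed

lemma d1_neg: "d1 (- a) (- b) (- c) = - d1 a b c"
proof (rule d1_unique)
  fix t
  have "e (- a + t, - b, - c) = e (a - t, b, c)"
    using scale3[of "-1" "a - t" b c] by simp
  then show "e (- a, - b, - c) + t * - d1 a b c \<le> e (- a + t, - b, - c)"
    using d1_subgradient[of a b c "- t"] scale3[of "-1" a b c] by simp
qed

text \<open>The tangents at both ends bound the value at the midpoint from below, while strict
  convexity puts it strictly below the average of the end values.\<close>

lemma d1_strict_mono:
  assumes "a < a'"
  shows "d1 a b c < d1 a' b c"
proof -
  have "2 * e ((a + a') / 2, (b + b) / 2, (c + c) / 2) < e (a, b, c) + e (a', b, c)"
    using assms by (intro strictly_convex3) auto
  moreover have "e (a, b, c) + (a' - a) / 2 * d1 a b c \<le> e ((a + a') / 2, b, c)"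
    using d1_subgradient[of a b c "(a' - a) / 2"] by (simp add: field_simps)
  moreover have "e (a', b, c) + (a - a') / 2 * d1 a' b c \<le> e ((a + a') / 2, b, c)"
    using d1_subgradient[of a' b c "(a - a') / 2"] by (simp add: field_simps)
  ultimately have "(a' - a) / 2 * d1 a b c + (a - a') / 2 * d1 a' b c < 0" by simp
  then have "(a' - a) * (d1 a b c - d1 a' b c) < 0" by (simp add: field_simps)
  then show ?thesis using assms by (simp add: mult_less_0_iff)
qed

lemma has_d1: "((\<lambda>t. e (a + t, b, c)) has_real_derivative d1 a b c) (at 0)"
  using has_directional_deriv[of "(a, b, c)" "(1, 0, 0)"] by (simp add: d1_def)

text \<open>By \<open>submodular\<close>, raising the other two values cannot enlarge an increment
  in the first variable; a larger derivative would contradict this on a short step.\<close>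

lemma d1_antimono:
  assumes "b \<le> b'" "c \<le> c'"
  shows "d1 a b' c' \<le> d1 a b c"
proof (rule ccontr)
  assume "\<not> ?thesis"
  then have neg: "d1 a b c - d1 a b' c' < 0" by simp
  have "((\<lambda>t. e (a + t, b, c) - e (a + t, b', c')) has_real_derivative d1 a b c - d1 a b' c') (at 0)"
    by (intro DERIV_diff has_d1)
  from DERIV_neg_dec_right[OF this neg] obtain \<delta> where \<delta>: "0 < \<delta>"
    "\<And>h. 0 < h \<Longrightarrow> h < \<delta> \<Longrightarrow> e (a + h, b, c) - e (a + h, b', c') < e (a, b, c) - e (a, b', c')"
    by auto
  have "e (a, b, c) + e (a + \<delta> / 2, b', c') \<le> e (a + \<delta> / 2, b, c) + e (a, b', c')"
    using submodular[of "a + \<delta> / 2" a b b' c c'] \<delta>(1) assms by (simp add: min_def max_def)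
  moreover have "e (a + \<delta> / 2, b, c) - e (a + \<delta> / 2, b', c') < e (a, b, c) - e (a, b', c')"
    using \<delta> by simp
  ultimately show False by simp
qed

section \<open>Harmonic extension to the midpoints\<close>

text \<open>\<open>(a, b, c)\<close> are boundary values and \<open>x, y, z\<close> are the values at the midpoints of the edges
  opposite to the vertices carrying \<open>a, b, c\<close> respectively.\<close>

definition refined where
  "refined a b c x y z = e (a, z, y) + e (z, b, x) + e (y, x, c)"

definition harmonic where
  "harmonic a b c x y z \<longleftrightarrow> (\<forall>x' y' z'. refined a b c x y z \<le> refined a b c x' y' z')"

text \<open>Truncation to the range of the boundary values does not increase energy, so a minimum
  over a compact cube is a global one.\<close>

lemma harmonic_exists: "\<exists>x y z. harmonic a b c x y z"
proof -
  define lo hi where "lo = min a (min b c)" and "hi = max a (max b c)"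
  define B where "B = {lo..hi} \<times> {lo..hi} \<times> {lo..hi}"
  have "compact B" by (simp add: B_def compact_Times)
  moreover have "B \<noteq> {}" by (auto simp: B_def lo_def hi_def)
  moreover have "continuous_on B (\<lambda>w. refined a b c (fst w) (fst (snd w)) (snd (snd w)))"
    unfolding refined_def
    by (intro continuous_intros continuous_on_compose2[OF continuous[of UNIV]]) auto
  ultimately obtain w where w: "w \<in> B"
    "\<forall>w'\<in>B. refined a b c (fst w) (fst (snd w)) (snd (snd w)) \<le> refined a b c (fst w') (fst (snd w')) (snd (snd w'))"
    using continuous_attains_inf by blast
  obtain x y z where [simp]: "w = (x, y, z)" by (cases w)
  have "refined a b c x y z \<le> refined a b c x' y' z'" for x' y' z'
  proof -
    define cl where "cl = (\<lambda>s. max lo (min hi s))"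
    have cl_le: "e (cl r, cl s, cl t) \<le> e (r, s, t)" for r s t
      unfolding cl_def by (rule order_trans[OF max_const_le min_const_le])
    have abc: "cl a = a" "cl b = b" "cl c = c" by (auto simp: cl_def lo_def hi_def)
    have "lo \<le> hi" by (simp add: lo_def hi_def)
    then have "(cl x', cl y', cl z') \<in> B" by (auto simp: B_def cl_def)
    then have "refined a b c x y z \<le> refined a b c (cl x') (cl y') (cl z')"
      using w(2) by force
    also have "\<dots> \<le> refined a b c x' y' z'"
      using cl_le[of a z' y'] cl_le[of z' b x'] cl_le[of y' x' c] by (simp add: refined_def abc)
    finally show ?thesis .
  qed
  then show ?thesis unfolding harmonic_def by blast
qed

text \<open>By strict convexity the average of two different minimisers would have less
  energy.\<close>

lemma harmonic_unique:
  assumes "harmonic a b c x y z" "harmonic a b c x' y' z'"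
  shows "x = x' \<and> y = y' \<and> z = z'"
proof (rule ccontr)
  assume ne: "\<not> ?thesis"
  have le: "2 * e (a, (z + z') / 2, (y + y') / 2) \<le> e (a, z, y) + e (a, z', y')"
    "2 * e ((z + z') / 2, b, (x + x') / 2) \<le> e (z, b, x) + e (z', b, x')"
    "2 * e ((y + y') / 2, (x + x') / 2, c) \<le> e (y, x, c) + e (y', x', c)"
    using midpoint_le3[of a a z z' y y'] midpoint_le3[of z z' b b x x'] midpoint_le3[of y y' x x' c c]
    by simp_all
  have "2 * refined a b c ((x + x') / 2) ((y + y') / 2) ((z + z') / 2)
      < refined a b c x y z + refined a b c x' y' z'"
  \<comment> \<open>A difference in \<open>x\<close> alone is invisible in the cell at the first
    vertex, but strict in the cell at the second, where the boundary value \<open>b\<close> excludes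
    a constant difference.\<close>
  proof (cases "y = y' \<and> z = z'")
    case True
    then have "2 * e ((z + z') / 2, b, (x + x') / 2) < e (z, b, x) + e (z', b, x')"
      using ne strictly_convex3[of z z' b b x x'] by simp
    then show ?thesis using le by (simp add: refined_def)
  next
    case False
    then have "2 * e (a, (z + z') / 2, (y + y') / 2) < e (a, z, y) + e (a, z', y')"
      using strictly_convex3[of a a z z' y y'] by auto
    then show ?thesis using le by (simp add: refined_def)
  qed
  moreover have "refined a b c x y z \<le> refined a b c ((x + x') / 2) ((y + y') / 2) ((z + z') / 2)"
    "refined a b c x' y' z' \<le> refined a b c ((x + x') / 2) ((y + y') / 2) ((z + z') / 2)"
    using assms by (simp_all add: harmonic_def)
  ultimately show False by simp
qed

lemma harmonic_const: "harmonic t t t t t t"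
  by (simp add: harmonic_def refined_def nonneg)

lemma harmonic_scale:
  assumes "harmonic a b c x y z" "0 \<le> s"
  shows "harmonic (s * a) (s * b) (s * c) (s * x) (s * y) (s * z)"
proof (cases "s = 0")
  case True
  then show ?thesis using harmonic_const[of 0] by simp
next
  case False
  have "refined (s * a) (s * b) (s * c) (s * x) (s * y) (s * z) \<le> refined (s * a) (s * b) (s * c) x' y' z'"
    for x' y' z'
  proof -
    have "refined (s * a) (s * b) (s * c) (s * x) (s * y) (s * z) = \<bar>s\<bar> powr p * refined a b c x y z"
      by (simp add: refined_def scale3 distrib_left)
    also have "\<dots> \<le> \<bar>s\<bar> powr p * refined a b c (x' / s) (y' / s) (z' / s)"
      using assms by (intro mult_left_mono) (auto simp: harmonic_def)
    also have "\<dots> = refined (s * a) (s * b) (s * c) x' y' z'"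
      using False by (simp add: refined_def distrib_left flip: scale3)
    finally show ?thesis .
  qed
  then show ?thesis by (simp add: harmonic_def)
qed

text \<open>The pointwise maximum competes for the larger data. Submodularity then makes the
  pointwise minimum a minimiser for the smaller data, and uniqueness identifies it with
  \<open>(x, y, z)\<close>.\<close>

lemma harmonic_comparison:
  assumes h: "harmonic a b c x y z" and h': "harmonic a' b' c' x' y' z'"
    and le: "a \<le> a'" "b \<le> b'" "c \<le> c'"
  shows "x \<le> x' \<and> y \<le> y' \<and> z \<le> z'"
proof -
  have "refined a b c (min x x') (min y y') (min z z') + refined a' b' c' (max x x') (max y y') (max z z')
      \<le> refined a b c x y z + refined a' b' c' x' y' z'"
    using submodular[of a a' z z' y y'] submodular[of z z' b b' x x'] submodular[of y y' x x' c c'] le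
    by (simp add: refined_def min_absorb1 max_absorb2)
  moreover have "refined a' b' c' x' y' z' \<le> refined a' b' c' (max x x') (max y y') (max z z')"
    using h' by (simp add: harmonic_def)
  ultimately have le: "refined a b c (min x x') (min y y') (min z z') \<le> refined a b c x y z"
    by simp
  have "harmonic a b c (min x x') (min y y') (min z z')"
    unfolding harmonic_def
  proof (intro allI)
    fix r s t
    have "refined a b c x y z \<le> refined a b c r s t" using h by (simp add: harmonic_def)
    with le show "refined a b c (min x x') (min y y') (min z z') \<le> refined a b c r s t" by simp
  qed
  from harmonic_unique[OF h this] show ?thesis by (auto simp: min_def split: if_splits)
qed

end

text \<open>The two transpositions generate all permutations of the vertices, so that
  \<open>d1\<close> alone expresses all three fluxes.\<close>

locale symmetric_triangle_form = triangle_form +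
  assumes sym12: "e (a, b, c) = e (b, a, c)"
    and sym23: "e (a, b, c) = e (a, c, b)"
begin

lemma d1_swap: "d1 a b c = d1 a c b"
  using d1_subgradient[of a c b] by (intro d1_unique) (simp add: sym23[of _ b c])

lemma d2_eq: "d2 a b c = d1 b a c"
  unfolding d2_def by (rule directional_deriv_unique) (simp add: sym12[of a] d1_subgradient)

lemma d3_eq: "d3 a b c = d1 c a b"
proof -
  have "e (a, b, t) = e (t, a, b)" for t
    using sym23[of a b t] sym12[of a t b] by simp
  then show ?thesis
    unfolding d3_def by (intro directional_deriv_unique) (simp add: d1_subgradient)
qed

lemma flux_sum: "d1 a b c + d1 b a c + d1 c a b = 0"
  using deriv_sum_eq_0[of a b c] by (simp add: d2_eq d3_eq)

lemma Euler: "a * d1 a b c + b * d1 b a c + c * d1 c a b = p * e (a, b, c)"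
  using Euler_identity[of a b c] by (simp add: d2_eq d3_eq)

lemma refined_swap12: "refined b a c y x z = refined a b c x y z"
  by (simp add: refined_def sym12[of b z x] sym12[of z a y] sym12[of x y c])

lemma refined_swap23: "refined a c b x z y = refined a b c x y z"
  by (simp add: refined_def sym23[of a y z] sym23[of y c x] sym23[of z x b])

lemma harmonic_swap12: "harmonic a b c x y z \<Longrightarrow> harmonic b a c y x z"
  by (auto simp: harmonic_def refined_swap12[of b a])

lemma harmonic_swap23: "harmonic a b c x y z \<Longrightarrow> harmonic a c b x z y"
  by (auto simp: harmonic_def refined_swap23[of a c b])

text \<open>Only the cells at \<open>a\<close> and \<open>b\<close> contain the midpoint carrying
  \<open>z\<close>; stationarity of the energy in \<open>z\<close> says that their fluxes
  cancel.\<close>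

lemma harmonic_flux_z:
  assumes "harmonic a b c x y z"
  shows "d1 z a y + d1 z b x = 0"
proof -
  have "((\<lambda>t. e (z + t, a, y) + e (z + t, b, x)) has_real_derivative d1 z a y + d1 z b x) (at 0)"
    by (intro DERIV_add has_d1)
  then show ?thesis
  proof (rule DERIV_local_min[of _ _ _ 1])
    show "\<forall>t. \<bar>0 - t\<bar> < 1 \<longrightarrow> e (z + 0, a, y) + e (z + 0, b, x) \<le> e (z + t, a, y) + e (z + t, b, x)"
    proof (intro allI impI)
      fix t
      have "refined a b c x y z \<le> refined a b c x y (z + t)"
        using assms by (simp add: harmonic_def)
      then show "e (z + 0, a, y) + e (z + 0, b, x) \<le> e (z + t, a, y) + e (z + t, b, x)"
        by (simp add: refined_def sym12[of a])
    qed
  qed simp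
qed

lemma harmonic_flux_y: "harmonic a b c x y z \<Longrightarrow> d1 y a z + d1 y c x = 0"
  using harmonic_flux_z[OF harmonic_swap23] .

lemma harmonic_flux_x: "harmonic a b c x y z \<Longrightarrow> d1 x b z + d1 x c y = 0"
  using harmonic_flux_y[OF harmonic_swap12] .

text \<open>Polarization with respect to the reflection exchanging the second and third vertices
  does not increase the energy of an extension.\<close>

lemma harmonic_polarization:
  assumes h: "harmonic a b c x y z" and "b \<le> c"
  shows "z \<le> y"
proof -
  have "e (a, min z y, max z y) = e (a, z, y)"
    by (simp add: min_def max_def sym23)
  moreover have "e (min z y, b, x) + e (max z y, c, x) \<le> e (z, b, x) + e (y, c, x)"
    using submodular[of z y b c x x] assms(2) by (simp add: min_absorb1 max_absorb2)
  ultimately have le: "refined a b c x (max z y) (min z y) \<le> refined a b c x y z"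
    by (simp add: refined_def sym23[of _ x c])
  have "harmonic a b c x (max z y) (min z y)"
    unfolding harmonic_def
  proof (intro allI)
    fix r s t
    have "refined a b c x y z \<le> refined a b c r s t" using h by (simp add: harmonic_def)
    with le show "refined a b c x (max z y) (min z y) \<le> refined a b c r s t" by simp
  qed
  from harmonic_unique[OF h this] show ?thesis by (auto simp: min_def split: if_splits)
qed

text \<open>After a shift making the mean 0, negating all values amounts to exchanging the last two,
  so the derivative is its own negative.\<close>

lemma d1_midpoint: "d1 ((s + t) / 2) s t = 0"
proof -
  define h where "h = (t - s) / 2"
  have "d1 ((s + t) / 2) s t = d1 0 (- h) h"
    using d1_shift[of 0 "(s + t) / 2" "- h" h] by (simp add: h_def field_simps)
  moreover have "d1 0 (- h) h = - d1 0 h (- h)"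
    using d1_neg[of 0 h "- h"] by simp
  moreover have "d1 0 h (- h) = d1 0 (- h) h" by (rule d1_swap)
  ultimately show ?thesis by linarith
qed

lemma d1_eq_0_imp_midpoint: "d1 m s t = 0 \<Longrightarrow> m = (s + t) / 2"
  using d1_midpoint[of s t] d1_strict_mono[of m "(s + t) / 2" s t] d1_strict_mono[of "(s + t) / 2" m s t]
  by (cases m "(s + t) / 2" rule: linorder_cases) simp_all

text \<open>\<open>d1_antimono\<close> gives only the weak inequality. Strictness comes from Euler's
  identity, which expresses the flux through the energy; the energy grows strictly as the third
  value leaves its minimum at the midpoint.\<close>

lemma d1_strict_past_midpoint:
  assumes "s < t" "(s + t) / 2 < x"
  shows "d1 s t x < d1 s t ((s + t) / 2)"
proof -
  define m where "m = (s + t) / 2"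
  \<comment> \<open>Capping at \<open>t\<close> keeps the term \<open>(x' - t) * d1 x' s t\<close>
    nonpositive; from \<open>x'\<close> on to \<open>x\<close> weak monotonicity is enough.\<close>
  define x' where "x' = min x t"
  have x': "m < x'" "x' \<le> t" using assms by (auto simp: m_def x'_def)
  have dm: "d1 m s t = 0" by (simp add: m_def d1_midpoint)
  have "d1 s t x \<le> d1 s t x'" by (intro d1_antimono) (auto simp: x'_def)
  moreover have "d1 s t x' < d1 s t m"
  proof -
    \<comment> \<open>Subtracting \<open>t\<close> times the vanishing flux sum from Euler's
      identity eliminates the flux at the second vertex.\<close>
    have id: "(s - t) * d1 s t r + (r - t) * d1 r s t = p * e (s, t, r)" for r
    proof -
      have "s * d1 s t r + t * d1 t s r + r * d1 r s t - t * (d1 s t r + d1 t s r + d1 r s t)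
          = p * e (s, t, r)"
        using Euler[of s t r] flux_sum[of s t r] by simp
      then show ?thesis by (simp add: algebra_simps)
    qed
    have "e (m, s, t) < e (x', s, t)"
    proof -
      define w where "w = (m + x') / 2"
      have "2 * e (w, s, t) < e (m, s, t) + e (x', s, t)"
        using strictly_convex3[of m x' s s t t] x' by (simp add: w_def)
      moreover have "e (m, s, t) \<le> e (w, s, t)"
        using d1_subgradient[of m s t "w - m"] dm by simp
      ultimately show ?thesis by simp
    qed
    then have "e (s, t, m) < e (s, t, x')"
      using sym12[of m s t] sym23[of s m t] sym12[of x' s t] sym23[of s x' t] by simp
    then have "p * e (s, t, m) < p * e (s, t, x')" using p_gt_1 by simp
    moreover have "0 < d1 x' s t" using d1_strict_mono[OF x'(1), of s t] dm by simp
    then have "(x' - t) * d1 x' s t \<le> 0" using x' by (simp add: mult_le_0_iff)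
    ultimately have "(s - t) * d1 s t m < (s - t) * d1 s t x'"
      using id[of m] id[of x'] dm by simp
    then show ?thesis using assms by (simp add: mult_less_cancel_left)
  qed
  ultimately show ?thesis by (simp add: m_def)
qed

lemma d1_00_eq_0_imp: "d1 0 0 t = 0 \<Longrightarrow> t = 0"
proof -
  assume "d1 0 0 t = 0"
  then have "d1 t 0 0 = d1 0 0 0" using flux_sum[of 0 0 t] by simp
  then show "t = 0" using d1_strict_mono[of t 0 0 0] d1_strict_mono[of 0 t 0 0]
    by (cases t "0::real" rule: linorder_cases) simp_all
qed

text \<open>The map sending boundary values to the values on the cell at the first vertex brings
  nonnegative data vanishing there closer to a multiple of \<open>(0, 1, 1)\<close>.\<close>

lemma harmonic_improves_ratio:
  assumes V: "harmonic 0 b 1 x y z" and b: "0 \<le> b" "b < 1"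
  shows "0 < y \<and> b * y < z \<and> z \<le> y"
proof -
  \<comment> \<open>The extension \<open>(m, l, l)\<close> of \<open>(0, 1, 1)\<close> and its
    multiple by \<open>b\<close> are upper and lower barriers for the extension of
    \<open>(0, b, 1)\<close>.\<close>
  obtain m l l' where "harmonic 0 1 1 m l l'" using harmonic_exists by blast
  moreover from harmonic_unique[OF this harmonic_swap23[OF this]] have "l' = l" by blast
  ultimately have U: "harmonic 0 1 1 m l l" by blast
  have pos: "0 \<le> x" "0 \<le> y" "0 \<le> z"
    using harmonic_comparison[OF harmonic_const[of 0] V] b by auto
  have zy: "z \<le> y" using harmonic_polarization[OF V] b by simp
  have ml: "0 \<le> m" "0 \<le> l" "l \<le> 1"
    using harmonic_comparison[OF harmonic_const[of 0] U] harmonic_comparison[OF U harmonic_const[of 1]] by auto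
  have bU: "harmonic 0 b b (b * m) (b * l) (b * l)"
    using harmonic_scale[OF U b(1)] by simp
  have lower: "b * m \<le> x" "b * l \<le> y" "b * l \<le> z"
    using harmonic_comparison[OF bU V] b by auto
  have upper: "x \<le> m" "y \<le> l" "z \<le> l"
    using harmonic_comparison[OF V U] b by auto
  have "d1 m l 1 = 0"
    using harmonic_flux_x[OF U] d1_swap[of m 1 l] by simp
  then have m: "m = (l + 1) / 2" by (rule d1_eq_0_imp_midpoint)
  have "l \<noteq> 1"
  proof
    assume "l = 1"
    then have "d1 1 0 1 = 0" using harmonic_flux_z[OF U] m by simp
    then have "d1 0 1 1 = 0" using flux_sum[of 1 0 1] d1_swap[of 1 1 0] by simp
    then have "p * e (0, 1, 1) = 0" using Euler[of 0 1 1] \<open>d1 1 0 1 = 0\<close> by simp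
    then show False using p_gt_1 eq_0_iff[of 0 1 1] by simp
  qed
  with ml have l1: "l < 1" by simp
  have "b * y < z"
  proof (rule ccontr)
    assume "\<not> b * y < z"
    then have touch: "z \<le> b * y" by simp
    show False
    proof (cases "b = 0")
      case True
      then have z: "z = 0" using touch pos by simp
      \<comment> \<open>Both terms are nonpositive, hence zero. All midpoint values then vanish,
        which contradicts the balance at \<open>y\<close>, next to the boundary value 1.\<close>
      have "d1 0 0 y + d1 0 0 x = 0" using harmonic_flux_z[OF V] z True by simp
      moreover have "d1 0 0 y \<le> d1 0 0 0" "d1 0 0 x \<le> d1 0 0 0"
        using d1_antimono[of 0 0 0 y 0] d1_antimono[of 0 0 0 x 0] pos by simp_all
      ultimately have "d1 0 0 y = 0" "d1 0 0 x = 0" by simp_all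
      then have "y = 0" "x = 0" by (simp_all add: d1_00_eq_0_imp)
      then have "d1 0 1 0 = 0" using harmonic_flux_y[OF V] z by simp
      then have "d1 0 0 1 = 0" using d1_swap[of 0 0 1] by simp
      then show False using d1_00_eq_0_imp by fastforce
    next
      case False
      with b have b0: "0 < b" by simp
      \<comment> \<open>The barriers leave no room: \<open>y\<close> must equal its upper barrier
        and \<open>z\<close> its lower one.\<close>
      have "b * l \<le> b * y" using touch lower by simp
      then have y: "y = l" using b0 upper by simp
      then have z: "z = b * l" using touch lower by simp
      \<comment> \<open>Comparing the balance at \<open>z\<close> for the lower barrier and for the
        actual extension pushes \<open>x\<close> down to its lower barrier too, by
        \<open>d1_strict_past_midpoint\<close>.\<close>
      have "b powr (p - 1) * (d1 l 0 l + d1 l 1 m) = 0" using harmonic_flux_z[OF U] by simp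
      then have "d1 (b * l) 0 (b * l) + d1 (b * l) b (b * m) = 0"
        using d1_scale[OF b0, of l 0 l] d1_scale[OF b0, of l 1 m] by (simp add: distrib_left)
      moreover have "d1 (b * l) 0 l + d1 (b * l) b x = 0"
        using harmonic_flux_z[OF V] y z by simp
      moreover have "d1 (b * l) 0 l \<le> d1 (b * l) 0 (b * l)"
        using b ml mult_right_mono[of b 1 l] by (intro d1_antimono) auto
      ultimately have ge: "d1 (b * l) b (b * m) \<le> d1 (b * l) b x" by simp
      have bm: "b * m = (b * l + b) / 2" by (simp add: m field_simps)
      have "b * l < b" using b0 l1 by simp
      then have "\<not> b * m < x"
        using d1_strict_past_midpoint[of "b * l" b x] ge by (auto simp: bm)
      with lower have x: "x = b * m" by simp
      \<comment> \<open>Now \<open>x\<close> is the mean of \<open>b\<close> and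
        \<open>b * l\<close>, so one flux vanishes in the balance at \<open>x\<close>. The other
        must vanish as well, making \<open>x\<close> the mean \<open>m\<close> of 1 and
        \<open>l\<close>.\<close>
      have "d1 (b * m) b (b * l) + d1 (b * m) 1 l = 0"
        using harmonic_flux_x[OF V] x y z by simp
      moreover have "d1 (b * m) b (b * l) = b powr (p - 1) * d1 m 1 l"
        using d1_scale[OF b0, of m 1 l] by simp
      moreover have "d1 m 1 l = 0" using \<open>d1 m l 1 = 0\<close> d1_swap[of m 1 l] by simp
      ultimately have "d1 (b * m) 1 l = 0" by simp
      then have "b * m = m"
        using d1_eq_0_imp_midpoint[of "b * m" 1 l] by (simp only: m add.commute)
      then show False using b m ml by simp
    qed
  qed
  moreover have "0 < y" using \<open>b * y < z\<close> zy pos by (cases "y = 0") auto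
  ultimately show ?thesis using zy by simp
qed

end

section \<open>Diagonal functions in invariant closed cones\<close>

context symmetric_triangle_form
begin

text \<open>Data in \<open>C\<close> normalised to maximum 1 form a compact set \<open>S\<close>, on
  which the smaller value attains its maximum. If that were below 1, the cell at the first vertex
  would give a better element.\<close>

lemma diagonal_mem:
  assumes "closed C"
    and scale_mem: "\<And>a b c t. (a, b, c) \<in> C \<Longrightarrow> (t * a, t * b, t * c) \<in> C"
    and cell_mem: "\<And>a b c x y z. (a, b, c) \<in> C \<Longrightarrow> harmonic a b c x y z \<Longrightarrow> (a, z, y) \<in> C"
    and start: "(0, \<beta>, \<gamma>) \<in> C" "0 \<le> \<beta>" "0 \<le> \<gamma>" "\<beta> \<noteq> 0 \<or> \<gamma> \<noteq> 0"
  shows "(0, 1, 1) \<in> C"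
proof -
  define S where "S = {w. max (fst w) (snd w) = (1::real) \<and> (0, fst w, snd w) \<in> C} \<inter> {0..1} \<times> {0..1}"
  have "S = ({w. max (fst w) (snd w) = 1} \<inter> (\<lambda>w. (0, fst w, snd w)) -` C) \<inter> {0..1} \<times> {0..1}"
    by (auto simp: S_def)
  moreover have "closed {w::real \<times> real. max (fst w) (snd w) = 1}"
    by (intro closed_Collect_eq continuous_intros)
  moreover have "closed ((\<lambda>w::real \<times> real. (0::real, fst w, snd w)) -` C)"
    by (intro closed_vimage assms(1) continuous_intros)
  ultimately have "compact S"
    by (simp add: closed_Int_compact closed_Int compact_Times)
  moreover have "S \<noteq> {}"
  proof -
    define s where "s = max \<beta> \<gamma>"
    have s: "0 < s" using start by (auto simp: s_def max_def)
    have "(1 / s * 0, 1 / s * \<beta>, 1 / s * \<gamma>) \<in> C" using start by (intro scale_mem)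
    then have "(\<beta> / s, \<gamma> / s) \<in> S"
      using s start by (auto simp: S_def s_def max_def)
    then show ?thesis by blast
  qed
  moreover have "continuous_on S (\<lambda>w. min (fst w) (snd w))"
    by (intro continuous_intros)
  ultimately obtain w where w: "w \<in> S" "\<And>v. v \<in> S \<Longrightarrow> min (fst v) (snd v) \<le> min (fst w) (snd w)"
    using continuous_attains_sup[of S "\<lambda>w. min (fst w) (snd w)"] by blast
  obtain b c where [simp]: "w = (b, c)" by (cases w)
  have bc: "(0, b, c) \<in> C" "max b c = 1" "0 \<le> b" "b \<le> 1" "0 \<le> c" "c \<le> 1"
    using w(1) by (auto simp: S_def)
  obtain x y z where h: "harmonic 0 b c x y z" using harmonic_exists by blast
  have cell: "(0, z, y) \<in> C" using cell_mem[OF bc(1) h] .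
  have "\<not> b < 1"
  proof
    assume b: "b < 1"
    then have c: "c = 1" using bc(2) by (auto simp: max_def split: if_splits)
    have r: "0 < y" "b * y < z" "z \<le> y"
      using harmonic_improves_ratio[of b x y z] h bc b by (simp_all add: c)
    have "0 < z" using r bc by (smt (verit) mult_nonneg_nonneg)
    \<comment> \<open>Dividing the cell values by their maximum \<open>y\<close> leaves the smaller
      value \<open>z / y\<close>, which exceeds \<open>b\<close>.\<close>
    have "(1 / y * 0, 1 / y * z, 1 / y * y) \<in> C" using cell by (rule scale_mem)
    then have "(z / y, 1) \<in> S"
      using r \<open>0 < z\<close> by (auto simp: S_def max_def)
    from w(2)[OF this] show False using r c b by (auto simp: min_def field_simps split: if_splits)
  qed
  moreover have "\<not> c < 1"
  proof
    assume c: "c < 1"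
    then have b: "b = 1" using bc(2) by (auto simp: max_def split: if_splits)
    have r: "0 < z" "c * z < y" "y \<le> z"
      using harmonic_improves_ratio[of c x z y] harmonic_swap23[OF h] bc c by (simp_all add: b)
    have "0 < y" using r bc by (smt (verit) mult_nonneg_nonneg)
    have "(1 / z * 0, 1 / z * z, 1 / z * y) \<in> C" using cell by (rule scale_mem)
    then have "(1, y / z) \<in> S"
      using r \<open>0 < y\<close> by (auto simp: S_def max_def)
    from w(2)[OF this] show False using r b c by (auto simp: min_def field_simps split: if_splits)
  qed
  ultimately show ?thesis using bc by (metis linorder_neqE_linordered_idom not_less)
qed

text \<open>A shift moves the extremum at the first vertex to 0, and a change of sign turns a
  maximum into a minimum.\<close>

lemma diagonal_mem_of_extremal:
  assumes "closed C"
    and scale_mem: "\<And>a b c t. (a, b, c) \<in> C \<Longrightarrow> (t * a, t * b, t * c) \<in> C"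
    and shift_mem: "\<And>a b c t. (a, b, c) \<in> C \<Longrightarrow> (a + t, b + t, c + t) \<in> C"
    and cell_mem: "\<And>a b c x y z. (a, b, c) \<in> C \<Longrightarrow> harmonic a b c x y z \<Longrightarrow> (a, z, y) \<in> C"
    and start: "(a, b, c) \<in> C" "a \<noteq> b \<or> b \<noteq> c" "a \<le> b \<and> a \<le> c \<or> b \<le> a \<and> c \<le> a"
  shows "(0, 1, 1) \<in> C"
  using start(3)
proof
  assume le: "a \<le> b \<and> a \<le> c"
  have "(a + - a, b + - a, c + - a) \<in> C" by (intro shift_mem start)
  then have mem: "(0, b - a, c - a) \<in> C" by simp
  show ?thesis
    by (rule diagonal_mem[where \<beta> = "b - a" and \<gamma> = "c - a", OF assms(1)])
      (erule scale_mem | erule (1) cell_mem | use le start(2) mem in auto)+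
next
  assume le: "b \<le> a \<and> c \<le> a"
  have "(- 1 * (a + - a), - 1 * (b + - a), - 1 * (c + - a)) \<in> C" by (intro scale_mem shift_mem start)
  then have mem: "(0, a - b, a - c) \<in> C" by simp
  show ?thesis
    by (rule diagonal_mem[where \<beta> = "a - b" and \<gamma> = "a - c", OF assms(1)])
      (erule scale_mem | erule (1) cell_mem | use le start(2) mem in auto)+
qed

end

section \<open>Uniqueness of the eigenform on three points\<close>

text \<open>The quotient is invariant under shifts and scaling, so its maximum may be sought among
  unit vectors with first coordinate 0, where \<open>e\<close> is positive.\<close>

lemma exists_maximal_ratio:
  assumes "triangle_form p e" "triangle_form p e'"
  obtains k a b c where "0 < k" "e' (a, b, c) = k * e (a, b, c)" "a \<noteq> b \<or> b \<noteq> c" "\<And>u. e' u \<le> k * e u"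
proof -
  interpret e: triangle_form p e by fact
  interpret e': triangle_form p e' by fact
  define S where "S = {u :: real \<times> real \<times> real. fst u = 0} \<inter> sphere 0 1"
  have nonconst: "b \<noteq> 0 \<or> c \<noteq> 0" if "(0, b, c) \<in> S" for b c
    using that by (auto simp: S_def simp flip: zero_prod_def)
  have pos: "0 < e u" "0 < e' u" if "u \<in> S" for u
    using that nonconst e.pos_iff e'.pos_iff by (cases u; force simp: S_def)+
  have "closed {u :: real \<times> real \<times> real. fst u = 0}"
    by (intro closed_Collect_eq continuous_intros)
  then have "compact S" by (simp add: S_def closed_Int_compact)
  moreover have "(0, 1, 0) \<in> S" by (simp add: S_def norm_Pair)
  then have "S \<noteq> {}" by blast
  moreover have "continuous_on S (\<lambda>u. e' u / e u)"
    using pos by (intro continuous_on_divide e.continuous e'.continuous) force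
  ultimately obtain u where u: "u \<in> S" "\<And>v. v \<in> S \<Longrightarrow> e' v / e v \<le> e' u / e u"
    using continuous_attains_sup[of S "\<lambda>u. e' u / e u"] by blast
  define k where "k = e' u / e u"
  obtain b c where [simp]: "u = (0, b, c)" using u(1) by (cases u) (auto simp: S_def)
  have bound: "e' (a, b, c) \<le> k * e (a, b, c)" for a b c
  proof (cases "a = b \<and> b = c")
    case False
    define v where "v = (0::real, b - a, c - a)"
    have ev: "e v = e (a, b, c)" "e' v = e' (a, b, c)"
      using e.shift[of a "- a" b c] e'.shift[of a "- a" b c] by (simp_all add: v_def)
    have "v \<noteq> 0" using False by (auto simp: v_def zero_prod_def)
    then have "norm ((1 / norm v) *\<^sub>R v) = 1" by simp
    moreover have "fst ((1 / norm v) *\<^sub>R v) = 0" by (simp add: v_def)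
    ultimately have v: "(1 / norm v) *\<^sub>R v \<in> S" by (simp add: S_def)
    have "e' ((1 / norm v) *\<^sub>R v) / e ((1 / norm v) *\<^sub>R v) = e' v / e v"
      using \<open>v \<noteq> 0\<close> by (simp add: e.scale e'.scale)
    then have "e' v / e v \<le> k" using u(2)[OF v] by (simp add: k_def)
    moreover have "0 < e v" using e.pos_iff[of a b c] False ev by auto
    ultimately show ?thesis by (simp add: ev pos_divide_le_eq)
  qed simp
  show ?thesis
  proof (rule that)
    show "0 < k" using pos[OF u(1)] by (simp add: k_def)
    show "e' (0, b, c) = k * e (0, b, c)" using pos(1)[OF u(1)] by (simp add: k_def)
    show "0 \<noteq> b \<or> b \<noteq> c" using nonconst u(1) by auto
    show "e' v \<le> k * e v" for v using bound by (cases v) auto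
  qed
qed

text \<open>The trace equation, with the infimum expressed by its value at a minimiser.\<close>

locale eigen_triangle_form = triangle_form +
  fixes \<rho> :: real
  assumes rho_pos: "0 < \<rho>"
    and eigen: "harmonic a b c x y z \<Longrightarrow> e (a, b, c) = \<rho> * refined a b c x y z"
begin

lemma eigen_le: "e (a, b, c) \<le> \<rho> * refined a b c x y z"
proof -
  obtain x' y' z' where h: "harmonic a b c x' y' z'" using harmonic_exists by blast
  then show ?thesis using rho_pos by (simp add: eigen[OF h] harmonic_def)
qed

end

locale eigen_pair =
  e: symmetric_triangle_form p e + e: eigen_triangle_form p e \<rho> + e': eigen_triangle_form p e' \<rho>
  for p e e' \<rho>
begin

text \<open>If \<open>k\<close> is an extremal value of \<open>e' / e\<close>, then all terms of
  \<open>k * \<R>(e) - \<R>(e')\<close> have the same sign, so that equality is inherited by the cells of a common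
  harmonic extension.\<close>

lemma extremal_cells:
  assumes k: "0 < k" "(\<forall>u. e' u \<le> k * e u) \<or> (\<forall>u. k * e u \<le> e' u)"
    and eq: "e' (a, b, c) = k * e (a, b, c)"
    and h: "e.harmonic a b c x y z"
  shows "e' (a, z, y) = k * e (a, z, y) \<and> e' (z, b, x) = k * e (z, b, x) \<and> e' (y, x, c) = k * e (y, x, c)"
  using k(2)
proof
  assume le: "\<forall>u. e' u \<le> k * e u"
  \<comment> \<open>The \<open>e\<close>-harmonic values compete in the minimisation for
    \<open>e'\<close>, which bounds the sum over the cells from below; the cellwise bounds go the
    other way.\<close>
  have "\<rho> * (k * e.refined a b c x y z) \<le> \<rho> * e'.refined a b c x y z"
    using e'.eigen_le[of a b c x y z] eq e.eigen[OF h] by (simp add: mult.left_commute)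
  then have "k * e.refined a b c x y z \<le> e'.refined a b c x y z"
    using e.rho_pos by simp
  moreover have "e' (a, z, y) \<le> k * e (a, z, y)" "e' (z, b, x) \<le> k * e (z, b, x)"
    "e' (y, x, c) \<le> k * e (y, x, c)"
    using le by auto
  ultimately show ?thesis
    by (simp add: e.refined_def e'.refined_def distrib_left)
next
  assume ge: "\<forall>u. k * e u \<le> e' u"
  \<comment> \<open>Now the \<open>e'\<close>-harmonic values serve as competitors for
    \<open>e\<close>. They turn out to be \<open>e\<close>-harmonic, hence equal to
    \<open>x\<close>, \<open>y\<close>, \<open>z\<close>.\<close>
  obtain r s t where h': "e'.harmonic a b c r s t" using e'.harmonic_exists by blast
  have cells: "k * e (a, t, s) \<le> e' (a, t, s)" "k * e (t, b, r) \<le> e' (t, b, r)"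
    "k * e (s, r, c) \<le> e' (s, r, c)"
    using ge by auto
  then have "k * e.refined a b c r s t \<le> e'.refined a b c r s t"
    by (simp add: e.refined_def e'.refined_def distrib_left)
  moreover have "\<rho> * e'.refined a b c r s t = \<rho> * (k * e.refined a b c x y z)"
    by (metis e'.eigen[OF h'] eq e.eigen[OF h] mult.left_commute)
  then have eqr: "e'.refined a b c r s t = k * e.refined a b c x y z"
    by (metis e.rho_pos less_irrefl mult_left_cancel)
  ultimately have "e.refined a b c r s t \<le> e.refined a b c x y z"
    using k(1) by simp
  then have "e.harmonic a b c r s t"
    using h unfolding e.harmonic_def by (meson order_trans)
  then have "r = x" "s = y" "t = z" using e.harmonic_unique[OF h] by auto
  with cells eqr show ?thesis
    by (simp add: e.refined_def e'.refined_def distrib_left)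
qed

text \<open>At most one of three values lies strictly between the others, so at least two vertices
  carry an extremum.\<close>

lemma extremal_two_diagonals:
  assumes k: "0 < k" "(\<forall>u. e' u \<le> k * e u) \<or> (\<forall>u. k * e u \<le> e' u)"
    and eq: "e' (a, b, c) = k * e (a, b, c)" "a \<noteq> b \<or> b \<noteq> c"
  defines "P \<equiv> \<lambda>u. e' u = k * e u"
  shows "P (0, 1, 1) \<and> P (1, 0, 1) \<or> P (0, 1, 1) \<and> P (1, 1, 0) \<or> P (1, 0, 1) \<and> P (1, 1, 0)"
proof -
  have closed: "closed {u. e' (f u) = k * e (f u)}" if "continuous_on UNIV f" for f :: "real \<times> real \<times> real \<Rightarrow> _"
    by (intro closed_Collect_eq continuous_intros continuous_on_compose2[OF e.continuous that]
        continuous_on_compose2[OF e'.continuous that]) auto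
  have scale: "e' (t * a, t * b, t * c) = k * e (t * a, t * b, t * c)"
    and shift: "e' (a + t, b + t, c + t) = k * e (a + t, b + t, c + t)"
    if "e' (a, b, c) = k * e (a, b, c)" for a b c t
    using that by (simp_all add: e.scale3 e'.scale3 e.shift e'.shift)
  note cells = extremal_cells[OF k]
  have 1: "P (0, 1, 1)" if "a \<le> b \<and> a \<le> c \<or> b \<le> a \<and> c \<le> a"
  proof -
    have "(0, 1, 1) \<in> {u. e' u = k * e u}"
      by (rule e.diagonal_mem_of_extremal[of _ a b c])
        (use closed[of "\<lambda>u. u"] eq that in \<open>auto dest: cells intro: scale shift\<close>)
    then show ?thesis by (simp add: P_def)
  qed
  have 2: "P (1, 0, 1)" if "b \<le> a \<and> b \<le> c \<or> a \<le> b \<and> c \<le> b"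
  proof -
    \<comment> \<open>Exchanging the first two coordinates puts the second vertex in first position;
      the third vertex is treated likewise below.\<close>
    have "(0, 1, 1) \<in> {u. e' (fst (snd u), fst u, snd (snd u)) = k * e (fst (snd u), fst u, snd (snd u))}"
    proof (rule e.diagonal_mem_of_extremal[of _ b a c])
      show "closed {u. e' (fst (snd u), fst u, snd (snd u)) = k * e (fst (snd u), fst u, snd (snd u))}"
        by (intro closed continuous_intros)
    next
      fix a b c x y z
      assume "(a, b, c) \<in> {u. e' (fst (snd u), fst u, snd (snd u)) = k * e (fst (snd u), fst u, snd (snd u))}"
        "e.harmonic a b c x y z"
      then show "(a, z, y) \<in> {u. e' (fst (snd u), fst u, snd (snd u)) = k * e (fst (snd u), fst u, snd (snd u))}"
        using cells[of b a c y x z] e.harmonic_swap12 by simp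
    qed (use eq that in \<open>auto intro: scale shift\<close>)
    then show ?thesis by (simp add: P_def)
  qed
  have 3: "P (1, 1, 0)" if "c \<le> a \<and> c \<le> b \<or> a \<le> c \<and> b \<le> c"
  proof -
    have "(0, 1, 1) \<in> {u. e' (snd (snd u), fst (snd u), fst u) = k * e (snd (snd u), fst (snd u), fst u)}"
    proof (rule e.diagonal_mem_of_extremal[of _ c b a])
      show "closed {u. e' (snd (snd u), fst (snd u), fst u) = k * e (snd (snd u), fst (snd u), fst u)}"
        by (intro closed continuous_intros)
    next
      fix a b c x y z
      assume "(a, b, c) \<in> {u. e' (snd (snd u), fst (snd u), fst u) = k * e (snd (snd u), fst (snd u), fst u)}"
        and "e.harmonic a b c x y z"
      moreover from this(2) have "e.harmonic c b a z y x"
        by (rule e.harmonic_swap12[OF e.harmonic_swap23[OF e.harmonic_swap12]])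
      ultimately show "(a, z, y) \<in> {u. e' (snd (snd u), fst (snd u), fst u) = k * e (snd (snd u), fst (snd u), fst u)}"
        using cells[of c b a z y x] by simp
    qed (use eq that in \<open>auto intro: scale shift\<close>)
    then show ?thesis by (simp add: P_def)
  qed
  show ?thesis using 1 2 3 by linarith
qed

theorem proportional: "\<exists>k>0. \<forall>u. e' u = k * e u"
proof -
  obtain k a b c where k: "0 < k" "e' (a, b, c) = k * e (a, b, c)" "a \<noteq> b \<or> b \<noteq> c" "\<And>u. e' u \<le> k * e u"
    using exists_maximal_ratio[OF e.triangle_form_axioms e'.triangle_form_axioms] by metis
  \<comment> \<open>With the roles exchanged, the minimum of \<open>e' / e\<close> is obtained as
    \<open>1 / l\<close>.\<close>
  obtain l a' b' c' where l: "0 < l" "e (a', b', c') = l * e' (a', b', c')" "a' \<noteq> b' \<or> b' \<noteq> c'" "\<And>u. e u \<le> l * e' u"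
    using exists_maximal_ratio[OF e'.triangle_form_axioms e.triangle_form_axioms] by metis
  have l': "0 < 1 / l" "e' (a', b', c') = 1 / l * e (a', b', c')" "\<And>u. 1 / l * e u \<le> e' u"
    using l by (simp_all add: field_simps)
  have w: "e (1, 0, 1) = e (0, 1, 1)" "e (1, 1, 0) = e (0, 1, 1)"
    using e.sym12[of 1 0 1] e.sym23[of 1 1 0] by simp_all
  have "0 < e (0, 1, 1)" by (simp add: e.pos_iff)
  \<comment> \<open>Two pairs chosen from three diagonals share a member, where both extremal ratios
    hold; symmetry of \<open>e\<close> moves the equation to \<open>(0, 1, 1)\<close>.\<close>
  moreover have "k * e (0, 1, 1) = 1 / l * e (0, 1, 1)"
    using extremal_two_diagonals[OF k(1) _ k(2,3)] extremal_two_diagonals[OF l'(1) _ l'(2) l(3)] k(4) l'(3) w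
    by metis
  ultimately have "k = 1 / l" by (metis less_irrefl mult_right_cancel)
  then have "e' u = k * e u" for u using k(4)[of u] l'(3)[of u] by (intro antisym) simp_all
  then show ?thesis using k(1) by blast
qed

end

section \<open>Resistance forms on three points\<close>

lemma powr_le_cancel_base:
  fixes a x y :: real
  assumes "0 < a" "0 \<le> x" "0 \<le> y" "x powr a \<le> y powr a"
  shows "x \<le> y"
  using powr_less_mono2[of a y x] assms by force

lemma convex_on_seminorm_powr:
  assumes N: "seminorm_on V N" and "1 \<le> p" "u \<in> rfun V" "v \<in> rfun V" "0 \<le> t" "t \<le> 1"
  shows "N (\<lambda>x\<in>V. (1 - t) * u x + t * v x) powr p \<le> (1 - t) * N u powr p + t * N v powr p"
proof -
  define u' v' where "u' = (\<lambda>x\<in>V. (1 - t) * u x)" and "v' = (\<lambda>x\<in>V. t * v x)"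
  have rf: "u' \<in> rfun V" "v' \<in> rfun V" by (auto simp: u'_def v'_def rfun_def)
  have "(\<lambda>x\<in>V. (1 - t) * u x + t * v x) = (\<lambda>x\<in>V. u' x + v' x)"
    by (auto simp: u'_def v'_def)
  then have "N (\<lambda>x\<in>V. (1 - t) * u x + t * v x) \<le> N u' + N v'"
    using N rf by (simp add: seminorm_on_def)
  also have "\<dots> = (1 - t) * N u + t * N v"
    using N assms by (simp add: seminorm_on_def u'_def v'_def)
  finally have le: "N (\<lambda>x\<in>V. (1 - t) * u x + t * v x) \<le> (1 - t) * N u + t * N v" .
  have "0 \<le> N (\<lambda>x\<in>V. (1 - t) * u x + t * v x)" "0 \<le> N u" "0 \<le> N v"
    using N assms by (auto simp: seminorm_on_def rfun_def)
  then have "N (\<lambda>x\<in>V. (1 - t) * u x + t * v x) powr p \<le> ((1 - t) * N u + t * N v) powr p"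
    using le assms by (intro powr_mono2) auto
  also have "\<dots> \<le> (1 - t) * N u powr p + t * N v powr p"
    using convex_onD[OF powr_convex_nonneg[OF assms(2)], of t "N u" "N v"] assms \<open>0 \<le> N u\<close> \<open>0 \<le> N v\<close>
    by simp
  finally show ?thesis .
qed

text \<open>The contraction property for maps of the plane with finite outer exponent, with all
  norms written out.\<close>

lemma contraction_property_pair:
  fixes T1 T2 :: "real \<Rightarrow> real \<Rightarrow> real"
  assumes cp: "contraction_property p V E"
    and q: "0 < q" "q \<le> p" "p \<le> r"
    and zero: "T1 0 0 = 0" "T2 0 0 = 0"
    and lip: "\<And>x y x' y'. (\<bar>T1 x y - T1 x' y'\<bar> powr r + \<bar>T2 x y - T2 x' y'\<bar> powr r) powr (1 / r)
      \<le> (\<bar>x - x'\<bar> powr q + \<bar>y - y'\<bar> powr q) powr (1 / q)"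
    and uv: "u \<in> rfun V" "v \<in> rfun V"
  shows "(E (\<lambda>x\<in>V. T1 (u x) (v x)) powr (r / p) + E (\<lambda>x\<in>V. T2 (u x) (v x)) powr (r / p)) powr (1 / r)
    \<le> (E u powr (q / p) + E v powr (q / p)) powr (1 / q)"
proof -
  have I: "{1..2::nat} = {1, 2}" by auto
  define T :: "(nat \<Rightarrow> real) \<Rightarrow> nat \<Rightarrow> real"
    where "T = (\<lambda>x. \<lambda>k\<in>{1..2}. if k = 1 then T1 (x 1) (x 2) else T2 (x 1) (x 2))"
  define w where "w = (\<lambda>j::nat. if j = 1 then u else v)"
  have norm2: "lnorm (ereal s) {1..2} x = (\<bar>x 1\<bar> powr s + \<bar>x 2\<bar> powr s) powr (1 / s)"
    for s and x :: "nat \<Rightarrow> real"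
    unfolding lnorm_def I by simp
  have "lnorm (ereal r) {1..2} (\<lambda>k. E (\<lambda>x\<in>V. T (\<lambda>j\<in>{1..2}. w j x) k) powr (1 / p))
      \<le> lnorm (ereal q) {1..2} (\<lambda>j. E (w j) powr (1 / p))"
  proof (rule cp[unfolded contraction_property_def, rule_format])
    show "T \<in> rfun {1..2} \<rightarrow> rfun {1..2}" by (auto simp: T_def rfun_def)
    show "T (\<lambda>j\<in>{1..2}. 0) = (\<lambda>k\<in>{1..2}. 0)" by (auto simp: T_def zero)
    show "lnorm (ereal r) {1..2} (\<lambda>k. T x k - T y k) \<le> lnorm (ereal q) {1..2} (\<lambda>j. x j - y j)" for x y
      unfolding norm2 by (simp add: T_def lip)
    show "w j \<in> rfun V" for j using uv by (simp add: w_def)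
  qed (use q in auto)
  moreover have "(\<lambda>x\<in>V. T (\<lambda>j\<in>{1..2}. w j x) 1) = (\<lambda>x\<in>V. T1 (u x) (v x))"
    "(\<lambda>x\<in>V. T (\<lambda>j\<in>{1..2}. w j x) 2) = (\<lambda>x\<in>V. T2 (u x) (v x))"
    by (auto simp: T_def w_def)
  ultimately show ?thesis
    unfolding norm2 by (simp add: w_def powr_powr)
qed

text \<open>The tangent inequality for the power \<open>\<alpha>\<close> bounds \<open>g t\<close>
  by a multiple of \<open>\<bar>t\<bar> powr q\<close>, and \<open>q\<close> exceeds 1.\<close>

lemma tendsto_quotient_of_powr_bound:
  fixes g :: "real \<Rightarrow> real"
  assumes q: "1 < q" "1 \<le> \<alpha>" and AB: "0 \<le> A" "0 \<le> B"
    and g: "\<And>t. 0 \<le> g t" "\<And>t. g t \<le> 2 * ((A + B * \<bar>t\<bar> powr q) powr \<alpha> - A powr \<alpha>)"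
  shows "((\<lambda>t. g t / t) \<longlongrightarrow> 0) (at 0)"
proof (rule Lim_null_comparison)
  define M where "M = 2 * \<alpha> * (A + B) powr (\<alpha> - 1) * B"
  have "((\<lambda>t::real. \<bar>t\<bar> powr (q - 1)) \<longlongrightarrow> \<bar>0\<bar> powr (q - 1)) (at 0)"
    using q by (intro tendsto_powr' tendsto_intros) auto
  then show "((\<lambda>t. M * \<bar>t\<bar> powr (q - 1)) \<longlongrightarrow> 0) (at 0)"
    using tendsto_mult_right_zero by simp
  have "norm (g t / t) \<le> M * \<bar>t\<bar> powr (q - 1)" if t: "t \<noteq> 0" "\<bar>t\<bar> < 1" for t
  proof -
    define y where "y = A + B * \<bar>t\<bar> powr q"
    have "\<bar>t\<bar> powr q \<le> 1" using t q by (intro powr_le1) auto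
    then have y: "0 \<le> y" "y \<le> A + B"
      using AB mult_left_mono[of "\<bar>t\<bar> powr q" 1 B] by (auto simp: y_def)
    have "y powr \<alpha> - A powr \<alpha> \<le> \<alpha> * y powr (\<alpha> - 1) * (y - A)"
      using powr_above_tangent[of \<alpha> A y] q AB y by (simp add: algebra_simps)
    also have "\<dots> \<le> \<alpha> * (A + B) powr (\<alpha> - 1) * (B * \<bar>t\<bar> powr q)"
      using y q AB by (intro mult_mono mult_left_mono powr_mono2) (auto simp: y_def)
    finally have "g t \<le> M * \<bar>t\<bar> powr q"
      using g(2)[of t] by (simp add: y_def M_def)
    also have "\<bar>t\<bar> powr q = \<bar>t\<bar> * \<bar>t\<bar> powr (q - 1)"
      using powr_mult_base[of "\<bar>t\<bar>" "q - 1"] by simp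
    finally show ?thesis
      using t g(1)[of t] by (simp add: divide_le_eq mult_ac)
  qed
  then show "\<forall>\<^sub>F t in at 0. norm (g t / t) \<le> M * \<bar>t\<bar> powr (q - 1)"
    unfolding eventually_at by (intro exI[of _ 1]) auto
qed

section \<open>Consequences of the contraction property\<close>

locale resistance =
  fixes p :: real and V :: "'a set" and E :: "('a \<Rightarrow> real) \<Rightarrow> real"
  assumes p1: "1 < p" and form: "resistance_form p V E"
begin

lemma nonneg: "u \<in> rfun V \<Longrightarrow> 0 \<le> E u"
  using form by (simp add: resistance_form_def)

lemma seminorm: "seminorm_on V (\<lambda>u. E u powr (1 / p))"
  using form by (simp add: resistance_form_def)

lemma contraction: "contraction_property p V E"
  using form by (simp add: resistance_form_def)

lemma zero_iff: "u \<in> rfun V \<Longrightarrow> E u = 0 \<longleftrightarrow> (\<exists>c. u = (\<lambda>x\<in>V. c))"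
  using form unfolding resistance_form_def by blast

lemma powr_powr_p: "u \<in> rfun V \<Longrightarrow> (E u powr (1 / p)) powr p = E u"
  using p1 nonneg by (simp add: powr_powr)

lemma restrict_in_rfun [simp, intro]: "restrict f V \<in> rfun V"
  by (simp add: rfun_def)

lemma scale:
  assumes "u \<in> rfun V"
  shows "E (\<lambda>x\<in>V. a * u x) = \<bar>a\<bar> powr p * E u"
proof -
  have "E (\<lambda>x\<in>V. a * u x) powr (1 / p) = \<bar>a\<bar> * E u powr (1 / p)"
    using seminorm assms by (simp add: seminorm_on_def)
  then have "(E (\<lambda>x\<in>V. a * u x) powr (1 / p)) powr p = \<bar>a\<bar> powr p * (E u powr (1 / p)) powr p"
    by (simp add: powr_mult)
  then show ?thesis using assms by (simp only: powr_powr_p restrict_in_rfun)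
qed

lemma convex_combination:
  assumes "u \<in> rfun V" "v \<in> rfun V" "0 \<le> t" "t \<le> 1"
  shows "E (\<lambda>x\<in>V. (1 - t) * u x + t * v x) \<le> (1 - t) * E u + t * E v"
  using convex_on_seminorm_powr[OF seminorm, of p u v t] p1 assms
  by (simp only: powr_powr_p restrict_in_rfun)

lemma add_const:
  assumes u: "u \<in> rfun V"
  shows "E (\<lambda>x\<in>V. u x + c) = E u"
proof -
  have le: "E (\<lambda>x\<in>V. u x + c) \<le> E u" if u: "u \<in> rfun V" for u c
  proof (rule powr_le_cancel_base)
    have "(\<lambda>x\<in>V. u x + c) = (\<lambda>x\<in>V. u x + (\<lambda>x\<in>V. c) x)" by auto
    moreover have "E (\<lambda>x\<in>V. c) = 0" by (subst zero_iff) auto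
    ultimately show "E (\<lambda>x\<in>V. u x + c) powr (1 / p) \<le> E u powr (1 / p)"
      using seminorm u restrict_in_rfun[of "\<lambda>_. c"] unfolding seminorm_on_def by fastforce
  qed (use p1 nonneg u in auto)
  have "(\<lambda>x\<in>V. (\<lambda>x\<in>V. u x + c) x + (- c)) = u"
    using u by (auto simp: rfun_def PiE_def extensional_def restrict_def)
  then show ?thesis using le[OF u, of c] le[of "\<lambda>x\<in>V. u x + c" "- c"] by simp
qed

lemma submodular:
  assumes "u \<in> rfun V" "v \<in> rfun V"
  shows "E (\<lambda>x\<in>V. min (u x) (v x)) + E (\<lambda>x\<in>V. max (u x) (v x)) \<le> E u + E v"
proof (rule powr_le_cancel_base)
  show "(E (\<lambda>x\<in>V. min (u x) (v x)) + E (\<lambda>x\<in>V. max (u x) (v x))) powr (1 / p) \<le> (E u + E v) powr (1 / p)"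
  proof -
    have "(\<bar>min x y - min x' y'\<bar> powr p + \<bar>max x y - max x' y'\<bar> powr p) powr (1 / p)
        \<le> (\<bar>x - x'\<bar> powr p + \<bar>y - y'\<bar> powr p) powr (1 / p)" for x y x' y'
      using p1 by (intro powr_mono2 min_max_powr_contraction) auto
    then show ?thesis
      using contraction_property_pair[OF contraction, of p p min max u v] assms p1 nonneg by simp
  qed
qed (use p1 assms nonneg in auto)

text \<open>The map is a multiple of \<open>(x + y, x - y)\<close>. Its second component contributes
  a positive energy \<open>B\<close>, and dropping it makes the inequality strict.\<close>

lemma strictly_convex:
  assumes u: "u \<in> rfun V" and v: "v \<in> rfun V" and ne: "E (\<lambda>x\<in>V. u x - v x) \<noteq> 0"
  shows "2 * E (\<lambda>x\<in>V. (u x + v x) / 2) < E u + E v"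
proof -
  obtain r where r: "p \<le> r"
    "\<And>x y :: real. 2 * (\<bar>x\<bar> powr r + \<bar>y\<bar> powr r) powr (p / r) \<le> \<bar>x + y\<bar> powr p + \<bar>x - y\<bar> powr p"
    using exists_convexity_exponent[OF p1] by blast
  \<comment> \<open>Normalised by \<open>(2 * k) powr p = 2\<close>, so that \<open>A\<close> is
    exactly twice the energy of the average.\<close>
  define k where "k = 2 powr (1 / p) / 2"
  define T1 T2 where "T1 = (\<lambda>x y. k * (x + y))" and "T2 = (\<lambda>x y. k * (x - y))"
  have kp: "(2 * k) powr p = 2" using p1 by (simp add: k_def powr_powr)
  have k0: "0 < k" by (simp add: k_def)
  have lip: "(\<bar>T1 x y - T1 x' y'\<bar> powr r + \<bar>T2 x y - T2 x' y'\<bar> powr r) powr (1 / r)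
      \<le> (\<bar>x - x'\<bar> powr p + \<bar>y - y'\<bar> powr p) powr (1 / p)" for x y x' y'
  proof -
    define a b where "a = ((x - x') + (y - y')) / 2" and "b = ((x - x') - (y - y')) / 2"
    have T: "T1 x y - T1 x' y' = 2 * k * a" "T2 x y - T2 x' y' = 2 * k * b"
      by (simp_all add: T1_def T2_def a_def b_def algebra_simps)
    have ab: "x - x' = a + b" "y - y' = a - b" by (simp_all add: a_def b_def field_simps)
    have "(\<bar>2 * k * a\<bar> powr r + \<bar>2 * k * b\<bar> powr r) powr (1 / r)
        = ((2 * k) powr r * (\<bar>a\<bar> powr r + \<bar>b\<bar> powr r)) powr (1 / r)"
      using k0 by (simp add: abs_mult powr_mult distrib_left)
    also have "\<dots> = 2 * k * (\<bar>a\<bar> powr r + \<bar>b\<bar> powr r) powr (1 / r)"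
      using k0 r p1 by (simp add: powr_mult powr_powr)
    also have "\<dots> = (2 * (\<bar>a\<bar> powr r + \<bar>b\<bar> powr r) powr (p / r)) powr (1 / p)"
      using p1 by (simp add: powr_mult powr_powr k_def)
    also have "\<dots> \<le> (\<bar>a + b\<bar> powr p + \<bar>a - b\<bar> powr p) powr (1 / p)"
      using p1 by (intro powr_mono2 r) auto
    finally show ?thesis unfolding T ab .
  qed
  define A B where "A = E (\<lambda>x\<in>V. T1 (u x) (v x))" and "B = E (\<lambda>x\<in>V. T2 (u x) (v x))"
  have "(A powr (r / p) + B powr (r / p)) powr (1 / r) \<le> (E u powr (p / p) + E v powr (p / p)) powr (1 / p)"
    unfolding A_def B_def
    using p1 r by (intro contraction_property_pair[OF contraction _ _ _ _ _ lip u v]) (auto simp: T1_def T2_def)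
  then have main: "(A powr (r / p) + B powr (r / p)) powr (1 / r) \<le> (E u + E v) powr (1 / p)"
    using p1 nonneg u v by simp
  have "A = E (\<lambda>x\<in>V. 2 * k * (\<lambda>x\<in>V. (u x + v x) / 2) x)"
    unfolding A_def T1_def by (intro arg_cong[where f = E]) auto
  then have A: "A = 2 * E (\<lambda>x\<in>V. (u x + v x) / 2)"
    using scale[of "\<lambda>x\<in>V. (u x + v x) / 2" "2 * k"] kp k0 by simp
  have "B = E (\<lambda>x\<in>V. k * (\<lambda>x\<in>V. u x - v x) x)"
    unfolding B_def T2_def by (intro arg_cong[where f = E]) auto
  then have "B = k powr p * E (\<lambda>x\<in>V. u x - v x)"
    using scale[of "\<lambda>x\<in>V. u x - v x" k] k0 by simp
  then have "0 < B" using ne nonneg[of "\<lambda>x\<in>V. u x - v x"] k0 by (simp add: less_le)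
  have A0: "0 \<le> A" using nonneg by (simp add: A_def)
  have "A powr (1 / p) = (A powr (r / p)) powr (1 / r)"
    using r p1 by (simp add: powr_powr)
  also have "\<dots> < (A powr (r / p) + B powr (r / p)) powr (1 / r)"
    using r p1 \<open>0 < B\<close> by (intro powr_less_mono2) auto
  finally have "A powr (1 / p) < (E u + E v) powr (1 / p)" using main by simp
  then have "A < E u + E v"
    using powr_mono2[of "1 / p" "E u + E v" A] p1 nonneg u v by force
  then show ?thesis by (simp add: A)
qed

text \<open>Now the inner exponent is the free one. The normalisation
  \<open>k powr p = 1 / 2\<close> turns the two-number inequality into a contraction from the
  \<open>q\<close>-norm to the \<open>p\<close>-norm.\<close>

lemma smooth_bound:
  obtains q c where "1 < q" "q \<le> p" "0 < c"
    "\<And>u v. u \<in> rfun V \<Longrightarrow> v \<in> rfun V \<Longrightarrow>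
      E (\<lambda>x\<in>V. u x + c * v x) + E (\<lambda>x\<in>V. u x - c * v x) \<le> 2 * (E u powr (q / p) + E v powr (q / p)) powr (p / q)"
proof -
  obtain q c where qc: "1 < q" "q \<le> p" "0 < c"
    "\<And>x y :: real. \<bar>x + c * y\<bar> powr p + \<bar>x - c * y\<bar> powr p \<le> 2 * (\<bar>x\<bar> powr q + \<bar>y\<bar> powr q) powr (p / q)"
    using exists_smoothness_exponent[OF p1] by blast
  define k where "k = 2 powr (- 1 / p)"
  define T1 T2 where "T1 = (\<lambda>x y. k * (x + c * y))" and "T2 = (\<lambda>x y. k * (x - c * y))"
  have "k powr p = 2 powr (- 1 / p * p)" by (simp only: k_def powr_powr)
  then have kp: "k powr p = 1 / 2" using p1 by simp
  have k0: "0 < k" by (simp add: k_def)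
  have lip: "(\<bar>T1 x y - T1 x' y'\<bar> powr p + \<bar>T2 x y - T2 x' y'\<bar> powr p) powr (1 / p)
      \<le> (\<bar>x - x'\<bar> powr q + \<bar>y - y'\<bar> powr q) powr (1 / q)" for x y x' y'
  proof -
    define a b where "a = x - x'" and "b = y - y'"
    have T: "T1 x y - T1 x' y' = k * (a + c * b)" "T2 x y - T2 x' y' = k * (a - c * b)"
      by (simp_all add: T1_def T2_def a_def b_def algebra_simps)
    have "\<bar>k * (a + c * b)\<bar> powr p + \<bar>k * (a - c * b)\<bar> powr p
        = (\<bar>a + c * b\<bar> powr p + \<bar>a - c * b\<bar> powr p) / 2"
      using k0 by (simp add: abs_mult powr_mult kp)
    also have "\<dots> \<le> (\<bar>a\<bar> powr q + \<bar>b\<bar> powr q) powr (p / q)"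
      using qc(4)[of a b] by simp
    finally have "(\<bar>k * (a + c * b)\<bar> powr p + \<bar>k * (a - c * b)\<bar> powr p) powr (1 / p)
        \<le> ((\<bar>a\<bar> powr q + \<bar>b\<bar> powr q) powr (p / q)) powr (1 / p)"
      using p1 by (intro powr_mono2) auto
    also have "\<dots> = (\<bar>a\<bar> powr q + \<bar>b\<bar> powr q) powr (1 / q)"
      using p1 by (simp add: powr_powr)
    finally show ?thesis unfolding T a_def b_def .
  qed
  have "E (\<lambda>x\<in>V. u x + c * v x) + E (\<lambda>x\<in>V. u x - c * v x) \<le> 2 * (E u powr (q / p) + E v powr (q / p)) powr (p / q)"
    if u: "u \<in> rfun V" and v: "v \<in> rfun V" for u v
  proof -
    define A B where "A = E (\<lambda>x\<in>V. T1 (u x) (v x))" and "B = E (\<lambda>x\<in>V. T2 (u x) (v x))"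
    have "(A powr (p / p) + B powr (p / p)) powr (1 / p) \<le> (E u powr (q / p) + E v powr (q / p)) powr (1 / q)"
      unfolding A_def B_def
      using p1 qc by (intro contraction_property_pair[OF contraction _ _ _ _ _ lip u v]) (auto simp: T1_def T2_def)
    moreover have "0 \<le> A" "0 \<le> B" using nonneg by (simp_all add: A_def B_def)
    ultimately have "((A + B) powr (1 / p)) powr p \<le> ((E u powr (q / p) + E v powr (q / p)) powr (1 / q)) powr p"
      using p1 by (intro powr_mono2) auto
    then have le: "A + B \<le> (E u powr (q / p) + E v powr (q / p)) powr (p / q)"
      using p1 \<open>0 \<le> A\<close> \<open>0 \<le> B\<close> by (simp add: powr_powr)
    have "A = E (\<lambda>x\<in>V. k * (\<lambda>x\<in>V. u x + c * v x) x)" "B = E (\<lambda>x\<in>V. k * (\<lambda>x\<in>V. u x - c * v x) x)"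
      unfolding A_def B_def T1_def T2_def by (auto intro!: arg_cong[where f = E])
    then have "A = E (\<lambda>x\<in>V. u x + c * v x) / 2" "B = E (\<lambda>x\<in>V. u x - c * v x) / 2"
      using scale[of "\<lambda>x\<in>V. u x + c * v x" k] scale[of "\<lambda>x\<in>V. u x - c * v x" k] k0 kp by simp_all
    then show ?thesis using le by simp
  qed
  then show ?thesis using that qc by blast
qed

lemma smooth:
  assumes u: "u \<in> rfun V" and v: "v \<in> rfun V"
  shows "((\<lambda>t. (E (\<lambda>x\<in>V. u x + t * v x) + E (\<lambda>x\<in>V. u x - t * v x) - 2 * E u) / t) \<longlongrightarrow> 0) (at 0)"
proof -
  obtain q c where qc: "1 < q" "q \<le> p" "0 < c" and bound:
    "\<And>u v. u \<in> rfun V \<Longrightarrow> v \<in> rfun V \<Longrightarrow>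
      E (\<lambda>x\<in>V. u x + c * v x) + E (\<lambda>x\<in>V. u x - c * v x) \<le> 2 * (E u powr (q / p) + E v powr (q / p)) powr (p / q)"
    using smooth_bound by blast
  show ?thesis
  proof (rule tendsto_quotient_of_powr_bound[of q "p / q" "E u powr (q / p)" "(1 / c) powr q * E v powr (q / p)"])
    fix t
    define U W where "U = (\<lambda>x\<in>V. u x + t * v x)" and "W = (\<lambda>x\<in>V. u x - t * v x)"
    have UW: "U \<in> rfun V" "W \<in> rfun V" by (simp_all add: U_def W_def)
    have "(\<lambda>x\<in>V. (1 - 1/2) * U x + 1/2 * W x) = u"
      using u by (auto simp: U_def W_def rfun_def PiE_def extensional_def restrict_def field_simps)
    then have "0 \<le> E U + E W - 2 * E u"
      using convex_combination[OF UW, of "1/2"] by simp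
    then show "0 \<le> E (\<lambda>x\<in>V. u x + t * v x) + E (\<lambda>x\<in>V. u x - t * v x) - 2 * E u"
      by (simp only: U_def W_def)
    \<comment> \<open>Dividing by \<open>c\<close> absorbs the constant of the bound; by homogeneity
      the energy of \<open>w\<close> enters as a multiple of
      \<open>\<bar>t\<bar> powr q\<close>.\<close>
    define w where "w = (\<lambda>x\<in>V. t / c * v x)"
    have w: "w \<in> rfun V" by (simp add: w_def)
    have "U = (\<lambda>x\<in>V. u x + c * w x)" "W = (\<lambda>x\<in>V. u x - c * w x)"
      using qc by (auto simp: w_def U_def W_def)
    then have "E U + E W \<le> 2 * (E u powr (q / p) + E w powr (q / p)) powr (p / q)"
      using bound[OF u w] by simp
    also have "E w = \<bar>t / c\<bar> powr p * E v"
      unfolding w_def by (rule scale[OF v])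
    also have "\<dots> powr (q / p) = (1 / c) powr q * E v powr (q / p) * \<bar>t\<bar> powr q"
      using p1 qc by (simp add: powr_mult powr_powr powr_divide abs_divide)
    finally have "E U + E W - 2 * E u \<le> 2 * ((E u powr (q / p) + (1 / c) powr q * E v powr (q / p) * \<bar>t\<bar> powr q) powr (p / q)
        - (E u powr (q / p)) powr (p / q))"
      using p1 qc nonneg[OF u] by (simp add: powr_powr)
    then show "E (\<lambda>x\<in>V. u x + t * v x) + E (\<lambda>x\<in>V. u x - t * v x) - 2 * E u
        \<le> 2 * ((E u powr (q / p) + (1 / c) powr q * E v powr (q / p) * \<bar>t\<bar> powr q) powr (p / q)
          - (E u powr (q / p)) powr (p / q))"
      by (simp only: U_def W_def)
  qed (use qc in auto)
qed

end

section \<open>Coordinates on three vertices\<close>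

definition triple_fun :: "'a \<Rightarrow> 'a \<Rightarrow> 'a \<Rightarrow> real \<times> real \<times> real \<Rightarrow> 'a \<Rightarrow> real" where
  "triple_fun v1 v2 v3 u =
    (\<lambda>x\<in>{v1, v2, v3}. if x = v1 then fst u else if x = v2 then fst (snd u) else snd (snd u))"

lemma triple_fun_in_rfun [simp]: "triple_fun v1 v2 v3 u \<in> rfun {v1, v2, v3}"
  by (auto simp: triple_fun_def rfun_def)

lemma triple_fun_eqI:
  assumes "f \<in> rfun {v1, v2, v3}" "v1 \<noteq> v2" "v1 \<noteq> v3" "v2 \<noteq> v3" "f v1 = a" "f v2 = b" "f v3 = c"
  shows "f = triple_fun v1 v2 v3 (a, b, c)"
  using assms by (auto simp: triple_fun_def rfun_def PiE_def extensional_def fun_eq_iff)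

lemma rfun_triple:
  assumes "f \<in> rfun {v1, v2, v3}" "v1 \<noteq> v2" "v1 \<noteq> v3" "v2 \<noteq> v3"
  shows "f = triple_fun v1 v2 v3 (f v1, f v2, f v3)"
  using triple_fun_eqI[OF assms] by blast

lemma resistance_form_triangle_form:
  assumes "1 < p" and form: "resistance_form p {v1, v2, v3} E"
    and ne: "v1 \<noteq> v2" "v1 \<noteq> v3" "v2 \<noteq> v3"
  shows "triangle_form p (\<lambda>u. E (triple_fun v1 v2 v3 u))"
proof -
  interpret resistance p "{v1, v2, v3}" E by unfold_locales fact+
  let ?V = "{v1, v2, v3}" and ?f = "triple_fun v1 v2 v3"
  have lin: "?f (s *\<^sub>R u + t *\<^sub>R w) = (\<lambda>x\<in>?V. s * ?f u x + t * ?f w x)" for s t u w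
    by (auto simp: triple_fun_def)
  have lin1: "?f (t *\<^sub>R u) = (\<lambda>x\<in>?V. t * ?f u x)" for t u
    by (auto simp: triple_fun_def)
  show ?thesis
  proof
    show "1 < p" by fact
    show "0 \<le> E (?f u)" for u by (rule nonneg) simp
    show "E (?f (t *\<^sub>R u)) = \<bar>t\<bar> powr p * E (?f u)" for t u
      unfolding lin1 by (rule scale) simp
    show "E (?f (a + t, b + t, c + t)) = E (?f (a, b, c))" for a b c t
    proof -
      have "?f (a + t, b + t, c + t) = (\<lambda>x\<in>?V. ?f (a, b, c) x + t)" by (auto simp: triple_fun_def)
      then show ?thesis by (simp add: add_const)
    qed
    show "a = b \<and> b = c" if "E (?f (a, b, c)) = 0" for a b c
    proof -
      from that obtain d where "?f (a, b, c) = (\<lambda>x\<in>?V. d)" using zero_iff by auto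
      then have "?f (a, b, c) x = (\<lambda>x\<in>?V. d) x" for x by simp
      from this[of v1] this[of v2] this[of v3] show ?thesis using ne by (simp add: triple_fun_def)
    qed
    show "convex_on UNIV (\<lambda>u. E (?f u))"
    proof (rule convex_onI)
      fix t :: real and u w :: "real \<times> real \<times> real" assume "0 < t" "t < 1"
      then show "E (?f ((1 - t) *\<^sub>R u + t *\<^sub>R w)) \<le> (1 - t) * E (?f u) + t * E (?f w)"
        unfolding lin by (intro convex_combination) auto
    qed simp
    show "2 * E (?f ((1 / 2) *\<^sub>R (u + w))) < E (?f u) + E (?f w)" if "E (?f (u - w)) \<noteq> 0" for u w
    proof -
      have "?f (u - w) = (\<lambda>x\<in>?V. ?f u x - ?f w x)"
        "?f ((1 / 2) *\<^sub>R (u + w)) = (\<lambda>x\<in>?V. (?f u x + ?f w x) / 2)"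
        by (auto simp: triple_fun_def)
      then show ?thesis using strictly_convex[of "?f u" "?f w"] that by simp
    qed
    show "((\<lambda>t. (E (?f (u + t *\<^sub>R w)) + E (?f (u - t *\<^sub>R w)) - 2 * E (?f u)) / t) \<longlongrightarrow> 0) (at 0)" for u w
    proof -
      have "?f (u + t *\<^sub>R w) = (\<lambda>x\<in>?V. ?f u x + t * ?f w x)"
        "?f (u - t *\<^sub>R w) = (\<lambda>x\<in>?V. ?f u x - t * ?f w x)" for t
        by (auto simp: triple_fun_def)
      then show ?thesis using smooth[of "?f u" "?f w"] by simp
    qed
    show "E (?f (min a a', min b b', min c c')) + E (?f (max a a', max b b', max c c'))
        \<le> E (?f (a, b, c)) + E (?f (a', b', c'))" for a a' b b' c c'
    proof -
      have "?f (min a a', min b b', min c c') = (\<lambda>x\<in>?V. min (?f (a, b, c) x) (?f (a', b', c') x))"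
        "?f (max a a', max b b', max c c') = (\<lambda>x\<in>?V. max (?f (a, b, c) x) (?f (a', b', c') x))"
        by (auto simp: triple_fun_def)
      then show ?thesis using submodular[of "?f (a, b, c)" "?f (a', b', c')"] by simp
    qed
  qed
qed

section \<open>The Sierpinski gasket\<close>

lemma sg_map_eq: "sg_map q i x = (1 / 2) *\<^sub>R (q i + x)"
proof -
  have "q i = (1 / 2) *\<^sub>R q i + (1 / 2) *\<^sub>R q i"
    by (simp flip: scaleR_add_left)
  then show ?thesis by (simp add: sg_map_def algebra_simps)
qed

lemma dist_sg_map: "dist (sg_map q i x) (sg_map q i y) = dist x y / 2"
proof -
  have "sg_map q i x - sg_map q i y = (1 / 2) *\<^sub>R (x - y)"
    by (simp add: sg_map_eq algebra_simps)
  then show ?thesis by (simp add: dist_norm)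
qed

lemma sg_map_fixed [simp]: "sg_map q i (q i) = q i"
  by (simp add: sg_map_def)

lemma sg_map_commute: "sg_map q i (q j) = sg_map q j (q i)"
  by (simp add: sg_map_eq add.commute)

lemma sierpinski_gasketD:
  assumes "sierpinski_gasket q K"
  shows "K \<noteq> {}" "compact K" "closed K"
    and "\<And>i x. i \<in> {1, 2, 3} \<Longrightarrow> x \<in> K \<Longrightarrow> sg_map q i x \<in> K"
    and "\<And>x. x \<in> K \<Longrightarrow> \<exists>i\<in>{1, 2, 3}. \<exists>y\<in>K. x = sg_map q i y"
proof -
  have K: "K \<noteq> {}" "compact K" "K = (\<Union>i\<in>{1,2,3}. sg_map q i ` K)"
    using assms by (simp_all add: sierpinski_gasket_def)
  show "K \<noteq> {}" "compact K" by fact+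
  then show "closed K" by (simp add: compact_imp_closed)
  show "sg_map q i x \<in> K" if "i \<in> {1, 2, 3}" "x \<in> K" for i x
    by (subst K(3)) (use that in blast)
  show "\<exists>i\<in>{1, 2, 3}. \<exists>y\<in>K. x = sg_map q i y" if "x \<in> K" for x
    using that by (subst (asm) K(3)) blast
qed

text \<open>A point of \<open>K\<close> farthest from \<open>L\<close> is the image of another point
  of \<open>K\<close>, and the map halves distances; so the largest distance is at most half of
  itself. Exchanging \<open>K\<close> and \<open>L\<close> gives uniqueness.\<close>

lemma sierpinski_gasket_subset:
  assumes K: "sierpinski_gasket q K" and L: "sierpinski_gasket q L"
  shows "K \<subseteq> L"
proof -
  note K = sierpinski_gasketD[OF K] and L = sierpinski_gasketD[OF L]
  have "continuous_on K (\<lambda>x. infdist x L)" by (intro continuous_intros)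
  then obtain x where x: "x \<in> K" "\<And>y. y \<in> K \<Longrightarrow> infdist y L \<le> infdist x L"
    using continuous_attains_sup[of K "\<lambda>x. infdist x L"] K by blast
  obtain i y where iy: "i \<in> {1, 2, 3}" "y \<in> K" "x = sg_map q i y" using K(5)[OF x(1)] by blast
  obtain z where z: "z \<in> L" "infdist y L = dist y z"
    using infdist_attains_inf[of L y] L by blast
  have "infdist x L \<le> dist x (sg_map q i z)" using L(4) iy z by (intro infdist_le) auto
  also have "\<dots> = infdist y L / 2" by (simp add: iy dist_sg_map z)
  also have "\<dots> \<le> infdist x L / 2" using x(2)[OF iy(2)] by simp
  finally have "infdist x L \<le> 0" by simp
  then have "infdist y L = 0" if "y \<in> K" for y
    using x(2)[OF that] infdist_nonneg[of y L] by linarith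
  then show ?thesis
    using in_closed_iff_infdist_zero[OF L(3) L(1)] by blast
qed

text \<open>The map fixing \<open>q i\<close> halves the distance from \<open>q i\<close> to a
  nearest point of \<open>K\<close> and stays in \<open>K\<close>, so that distance is 0.\<close>

lemma vertex_in_gasket:
  assumes K: "sierpinski_gasket q K" and i: "i \<in> {1, 2, 3}"
  shows "q i \<in> K"
proof -
  note K = sierpinski_gasketD[OF K]
  obtain z where z: "z \<in> K" "infdist (q i) K = dist (q i) z"
    using infdist_attains_inf[of K "q i"] K by blast
  have "infdist (q i) K \<le> dist (q i) (sg_map q i z)" using K(4) i z by (intro infdist_le) auto
  also have "\<dots> = infdist (q i) K / 2" using dist_sg_map[of q i "q i" z] z by simp
  finally have "infdist (q i) K = 0" using infdist_nonneg[of "q i" K] by linarith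
  then show ?thesis using in_closed_iff_infdist_zero[OF K(3) K(1)] by blast
qed

text \<open>The orthogonal reflection in the perpendicular bisector of \<open>a\<close> and
  \<open>b\<close>; for \<open>a = b\<close> it is the identity.\<close>

definition reflection :: "'a::real_inner \<Rightarrow> 'a \<Rightarrow> 'a \<Rightarrow> 'a" where
  "reflection a b x = x - (2 * ((x - (1 / 2) *\<^sub>R (a + b)) \<bullet> (a - b)) / ((a - b) \<bullet> (a - b))) *\<^sub>R (a - b)"

lemma dist_reflection: "dist (reflection a b x) (reflection a b y) = dist x y"
proof (cases "a = b")
  case False
  define n w where "n = a - b" and "w = x - y"
  define s where "s = (w \<bullet> n) / (n \<bullet> n)"
  have s: "s * (n \<bullet> n) = w \<bullet> n" using False by (simp add: s_def n_def)
  have "reflection a b x - reflection a b y = w - (2 * s) *\<^sub>R n"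
    by (simp add: reflection_def w_def s_def n_def inner_diff_left diff_divide_distrib
        scaleR_left_diff_distrib right_diff_distrib)
  moreover have "(w - (2 * s) *\<^sub>R n) \<bullet> (w - (2 * s) *\<^sub>R n) = w \<bullet> w - 4 * s * (w \<bullet> n) + 4 * s * (s * (n \<bullet> n))"
    by (simp add: inner_diff_left inner_diff_right inner_commute algebra_simps)
  then have "(w - (2 * s) *\<^sub>R n) \<bullet> (w - (2 * s) *\<^sub>R n) = w \<bullet> w" by (simp add: s)
  ultimately show ?thesis by (simp add: dist_norm norm_eq_sqrt_inner w_def)
qed (simp add: reflection_def)

lemma reflection_left: "reflection a b a = b"
proof (cases "a = b")
  case False
  have "a - (1 / 2) *\<^sub>R (a + b) = (1 / 2) *\<^sub>R (a - b)"
    by (simp add: algebra_simps flip: scaleR_add_left)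
  then show ?thesis using False by (simp add: reflection_def)
qed (simp add: reflection_def)

lemma reflection_right: "reflection a b b = a"
proof (cases "a = b")
  case False
  have "b - (1 / 2) *\<^sub>R (a + b) = (- 1 / 2) *\<^sub>R (a - b)"
    by (simp add: algebra_simps flip: scaleR_add_left)
  then show ?thesis using False by (simp add: reflection_def)
qed (simp add: reflection_def)

lemma reflection_fixed:
  assumes "dist c a = dist c b"
  shows "reflection a b c = c"
proof -
  have "(c - a) \<bullet> (c - a) = (c - b) \<bullet> (c - b)"
    using assms by (simp add: dist_norm norm_eq_sqrt_inner)
  then have "(c - (1 / 2) *\<^sub>R (a + b)) \<bullet> (a - b) = 0"
    by (simp add: inner_diff_left inner_diff_right inner_add_left inner_commute algebra_simps)
  then show ?thesis by (simp add: reflection_def)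
qed

text \<open>Each \<open>sg_map\<close> takes the midpoint with a vertex, so this determines how it
  interacts with a reflection.\<close>

lemma reflection_midpoint:
  "reflection a b ((1 / 2) *\<^sub>R (x + y)) = (1 / 2) *\<^sub>R (reflection a b x + reflection a b y)"
proof -
  define m n where "m = (1 / 2) *\<^sub>R (a + b)" and "n = a - b"
  have "(1 / 2) *\<^sub>R (x + y) - m = (1 / 2) *\<^sub>R ((x - m) + (y - m))"
    by (simp add: algebra_simps flip: scaleR_add_left)
  then have "2 * (((1 / 2) *\<^sub>R (x + y) - m) \<bullet> n) / (n \<bullet> n)
      = (1 / 2) * (2 * ((x - m) \<bullet> n) / (n \<bullet> n) + 2 * ((y - m) \<bullet> n) / (n \<bullet> n))"
    by (simp add: inner_add_left add_divide_distrib)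
  then show ?thesis
    unfolding reflection_def m_def[symmetric] n_def[symmetric]
    by (simp only:) (simp add: algebra_simps)
qed

text \<open>The reflected set solves the same self-similarity equation with two cells exchanged, so
  by uniqueness it is \<open>K\<close> again.\<close>

lemma gasket_reflection:
  assumes eq: "equilateral q" and K: "sierpinski_gasket q K"
    and ijk: "{i, j, k} = {1, 2, 3}" "k \<noteq> i" "k \<noteq> j"
  obtains g where "g \<in> isometries K" "g (q i) = q j" "g (q j) = q i" "g (q k) = q k"
proof -
  have mem: "i \<in> {1, 2, 3}" "j \<in> {1, 2, 3}" "k \<in> {1, 2, 3}" using ijk by blast+
  define r where "r = reflection (q i) (q j)"
  obtain d where d: "\<And>i j. i \<in> {1,2,3} \<Longrightarrow> j \<in> {1,2,3} \<Longrightarrow> i \<noteq> j \<Longrightarrow> dist (q i) (q j) = d"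
    using eq unfolding equilateral_def by blast
  have r: "r (q i) = q j" "r (q j) = q i" "r (q k) = q k"
    using d mem ijk by (simp_all add: r_def reflection_left reflection_right reflection_fixed)
  have dist_r: "dist (r x) (r y) = dist x y" for x y by (simp add: r_def dist_reflection)
  have r_sg: "r (sg_map q l x) = (1 / 2) *\<^sub>R (r (q l) + r x)" for l x
    by (simp add: r_def sg_map_eq reflection_midpoint)
  have cont: "continuous_on K r"
    unfolding continuous_on_iff dist_r by blast
  have "r (sg_map q i x) = sg_map q j (r x)" "r (sg_map q j x) = sg_map q i (r x)"
    "r (sg_map q k x) = sg_map q k (r x)" for x
    using r_sg[of i x] r_sg[of j x] r_sg[of k x] r
      sg_map_eq[of q j "r x"] sg_map_eq[of q i "r x"] sg_map_eq[of q k "r x"] by simp_all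
  then have step: "r ` sg_map q i ` K = sg_map q j ` r ` K" "r ` sg_map q j ` K = sg_map q i ` r ` K"
    "r ` sg_map q k ` K = sg_map q k ` r ` K"
    by (simp_all add: image_image)
  have "sierpinski_gasket q (r ` K)"
    unfolding sierpinski_gasket_def
  proof (intro conjI)
    show "r ` K \<noteq> {}" using sierpinski_gasketD(1)[OF K] by simp
    show "compact (r ` K)"
      using compact_continuous_image[OF cont sierpinski_gasketD(2)[OF K]] .
    have "K = (\<Union>l\<in>{i, j, k}. sg_map q l ` K)"
      using K by (simp only: sierpinski_gasket_def ijk)
    then have "r ` K = r ` (\<Union>l\<in>{i, j, k}. sg_map q l ` K)" by simp
    also have "\<dots> = r ` sg_map q i ` K \<union> r ` sg_map q j ` K \<union> r ` sg_map q k ` K"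
      by (simp add: image_Un Un_assoc)
    also have "\<dots> = (\<Union>l\<in>{i, j, k}. sg_map q l ` r ` K)"
      unfolding step by auto
    finally show "r ` K = (\<Union>l\<in>{1, 2, 3}. sg_map q l ` r ` K)" by (simp only: ijk)
  qed
  then have rK: "r ` K = K"
    using sierpinski_gasket_subset K by blast
  have "restrict r K \<in> isometries K"
    using rK by (auto simp: isometries_def dist_r)
  moreover have "restrict r K (q l) = r (q l)" if "l \<in> {1, 2, 3}" for l
    using vertex_in_gasket[OF K that] by simp
  ultimately show ?thesis using that[of "restrict r K"] r mem by simp
qed

section \<open>The trace equation in coordinates\<close>

locale equilateral_triangle =
  fixes q :: "nat \<Rightarrow> real ^ 2"
  assumes equilateral: "equilateral q"
begin

abbreviation vertex_fun :: "real \<times> real \<times> real \<Rightarrow> real ^ 2 \<Rightarrow> real" where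
  "vertex_fun \<equiv> triple_fun (q 1) (q 2) (q 3)"

lemma sg_V0_eq: "sg_V0 q = {q 1, q 2, q 3}"
  by (simp add: sg_V0_def)

lemma vertices_distinct: "q 1 \<noteq> q 2" "q 1 \<noteq> q 3" "q 2 \<noteq> q 3"
  using equilateral by (force simp: equilateral_def)+

lemma sg_V1_eq:
  "sg_V1 q = {q 1, q 2, q 3, sg_map q 2 (q 3), sg_map q 1 (q 3), sg_map q 1 (q 2)}"
  using sg_map_commute[of q 2 1] sg_map_commute[of q 3 1] sg_map_commute[of q 3 2]
  by (auto simp: sg_V1_def sg_V0_eq)

text \<open>The midpoint has distance \<open>d / 2\<close> from \<open>q i\<close>, but vertices
  have distance 0 or \<open>d\<close>.\<close>

lemma midpoint_neq_vertex:
  assumes "i \<in> {1, 2, 3}" "j \<in> {1, 2, 3}" "k \<in> {1, 2, 3}" "i \<noteq> j"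
  shows "sg_map q i (q j) \<noteq> q k"
proof
  assume eq: "sg_map q i (q j) = q k"
  obtain d where d: "0 < d" "\<And>i j. i \<in> {1,2,3} \<Longrightarrow> j \<in> {1,2,3} \<Longrightarrow> i \<noteq> j \<Longrightarrow> dist (q i) (q j) = d"
    using equilateral unfolding equilateral_def by blast
  have "dist (q i) (q k) = d / 2"
    using dist_sg_map[of q i "q i" "q j"] d(2)[OF assms(1,2,4)] by (simp add: eq)
  then show False using d assms by (cases "i = k") auto
qed

lemma midpoints_distinct:
  "sg_map q 1 (q 2) \<noteq> sg_map q 1 (q 3)" "sg_map q 1 (q 2) \<noteq> sg_map q 2 (q 3)"
  "sg_map q 1 (q 3) \<noteq> sg_map q 2 (q 3)"
  using vertices_distinct by (auto simp: sg_map_eq)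

end

locale gasket_eigenform = equilateral_triangle +
  fixes p \<rho> :: real and E :: "(real ^ 2 \<Rightarrow> real) \<Rightarrow> real"
  assumes p_gt_1: "1 < p" and rho_pos: "0 < \<rho>" and eigenform: "eigenform q p \<rho> E"
begin

sublocale triangle_form p "\<lambda>u. E (vertex_fun u)"
  using eigenform vertices_distinct p_gt_1
  by (intro resistance_form_triangle_form) (simp_all add: eigenform_def sg_V0_eq)

lemma renormalization_eq:
  assumes v: "v \<in> rfun (sg_V1 q)"
  shows "renormalization q \<rho> E v = \<rho> * refined (v (q 1)) (v (q 2)) (v (q 3))
    (v (sg_map q 2 (q 3))) (v (sg_map q 1 (q 3))) (v (sg_map q 1 (q 2)))"
proof -
  have cell: "restrict (v \<circ> sg_map q i) (sg_V0 q)
      = vertex_fun (v (sg_map q i (q 1)), v (sg_map q i (q 2)), v (sg_map q i (q 3)))" for i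
    by (rule triple_fun_eqI) (use vertices_distinct in \<open>auto simp: sg_V0_eq rfun_def\<close>)
  show ?thesis
    unfolding renormalization_def cell refined_def
    by (simp add: distrib_left sg_map_commute[of q 2 1] sg_map_commute[of q 3 1]
        sg_map_commute[of q 3 2] del: One_nat_def)
qed

text \<open>As the six points of \<open>sg_V1 q\<close> are distinct, extending boundary data means
  choosing three midpoint values freely.\<close>

lemma extension_values:
  "{renormalization q \<rho> E v |v. v \<in> rfun (sg_V1 q) \<and> restrict v (sg_V0 q) = vertex_fun (a, b, c)}
    = {\<rho> * refined a b c x y z |x y z. True}" (is "?L = ?R")
proof
  show "?L \<subseteq> ?R"
  proof
    fix s assume "s \<in> ?L"
    then obtain v where v: "s = renormalization q \<rho> E v" "v \<in> rfun (sg_V1 q)"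
      "restrict v (sg_V0 q) = vertex_fun (a, b, c)" by blast
    have "restrict v (sg_V0 q) x = vertex_fun (a, b, c) x" for x using v(3) by simp
    from this[of "q 1"] this[of "q 2"] this[of "q 3"] have "v (q 1) = a" "v (q 2) = b" "v (q 3) = c"
      using vertices_distinct by (simp_all add: sg_V0_eq triple_fun_def)
    then show "s \<in> ?R" using renormalization_eq[OF v(2)] v(1) by auto
  qed
  show "?R \<subseteq> ?L"
  proof
    fix s assume "s \<in> ?R"
    then obtain x y z where s: "s = \<rho> * refined a b c x y z" by blast
    define v where "v = (\<lambda>w\<in>sg_V1 q. if w = q 1 then a else if w = q 2 then b else if w = q 3 then c
      else if w = sg_map q 2 (q 3) then x else if w = sg_map q 1 (q 3) then y else z)"
    have v: "v \<in> rfun (sg_V1 q)" by (simp add: v_def rfun_def)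
    have vals: "v (q 1) = a" "v (q 2) = b" "v (q 3) = c" "v (sg_map q 2 (q 3)) = x"
      "v (sg_map q 1 (q 3)) = y" "v (sg_map q 1 (q 2)) = z"
      using vertices_distinct midpoints_distinct midpoint_neq_vertex[of 2 3] midpoint_neq_vertex[of 1 3]
        midpoint_neq_vertex[of 1 2]
      by (auto simp: v_def sg_V1_eq)
    have "restrict v (sg_V0 q) = vertex_fun (a, b, c)"
      by (rule triple_fun_eqI) (use vertices_distinct vals in \<open>auto simp: sg_V0_eq rfun_def\<close>)
    moreover have "s = renormalization q \<rho> E v"
      unfolding renormalization_eq[OF v] vals by (rule s)
    ultimately show "s \<in> ?L" using v by blast
  qed
qed

sublocale eigen_triangle_form p "\<lambda>u. E (vertex_fun u)" \<rho>
proof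
  show "0 < \<rho>" by (rule rho_pos)
  fix a b c x y z assume h: "harmonic a b c x y z"
  have "E (vertex_fun (a, b, c)) = trace_form (sg_V1 q) (sg_V0 q) (renormalization q \<rho> E) (vertex_fun (a, b, c))"
    using eigenform by (simp add: eigenform_def sg_V0_eq)
  also have "\<dots> = Inf {\<rho> * refined a b c x y z |x y z. True}"
    by (simp only: trace_form_def extension_values)
  also have "\<dots> = \<rho> * refined a b c x y z"
    using h[unfolded harmonic_def] rho_pos
    by (intro cInf_eq_minimum) (auto intro: mult_left_mono simp del: One_nat_def)
  finally show "E (vertex_fun (a, b, c)) = \<rho> * refined a b c x y z" .
qed

text \<open>The reflections exchanging \<open>q 1\<close> with \<open>q 2\<close> and
  \<open>q 2\<close> with \<open>q 3\<close> are isometries of \<open>K\<close> and realise the two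
  transpositions.\<close>

lemma symmetric:
  assumes K: "sierpinski_gasket q K" and sym: "sym_invariant q K E"
  shows "symmetric_triangle_form p (\<lambda>u. E (vertex_fun u))"
proof unfold_locales
  have inv: "E (restrict (vertex_fun u \<circ> g) (sg_V0 q)) = E (vertex_fun u)" if "g \<in> isometries K" for u g
    using sym that by (simp add: sym_invariant_def sg_V0_eq)
  fix a b c
  obtain g where g: "g \<in> isometries K" "g (q 1) = q 2" "g (q 2) = q 1" "g (q 3) = q 3"
    using gasket_reflection[OF equilateral K, of 1 2 3] by auto
  have "restrict (vertex_fun (a, b, c) \<circ> g) (sg_V0 q) = vertex_fun (b, a, c)"
    by (rule triple_fun_eqI)
      (use vertices_distinct g in \<open>auto simp: sg_V0_eq rfun_def triple_fun_def\<close>)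
  then show "E (vertex_fun (a, b, c)) = E (vertex_fun (b, a, c))"
    using inv[OF g(1), of "(a, b, c)"] by simp
  obtain h where h: "h \<in> isometries K" "h (q 2) = q 3" "h (q 3) = q 2" "h (q 1) = q 1"
    using gasket_reflection[OF equilateral K, of 2 3 1] by auto
  have "restrict (vertex_fun (a, b, c) \<circ> h) (sg_V0 q) = vertex_fun (a, c, b)"
    by (rule triple_fun_eqI)
      (use vertices_distinct h in \<open>auto simp: sg_V0_eq rfun_def triple_fun_def\<close>)
  then show "E (vertex_fun (a, b, c)) = E (vertex_fun (a, c, b))"
    using inv[OF h(1), of "(a, b, c)"] by simp
qed

end

theorem theorem3p22:
  fixes p \<rho> :: real
    and q :: "nat \<Rightarrow> real ^ 2"
    and K :: "(real ^ 2) set"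
    and E E' :: "(real ^ 2 \<Rightarrow> real) \<Rightarrow> real"
  assumes "1 < p"
    and "equilateral q"
    and "sierpinski_gasket q K"
    and "0 < \<rho>"
    and "eigenform q p \<rho> E"
    and "sym_invariant q K E"
    and "eigenform q p \<rho> E'"
  shows "\<exists>c>0. \<forall>u\<in>rfun (sg_V0 q). E' u = c * E u"
proof -
  interpret E: gasket_eigenform q p \<rho> E
    using assms by unfold_locales
  interpret E': gasket_eigenform q p \<rho> E'
    using assms by unfold_locales
  interpret symmetric_triangle_form p "\<lambda>u. E (E.vertex_fun u)"
    using assms by (intro E.symmetric)
  interpret eigen_pair p "\<lambda>u. E (E.vertex_fun u)" "\<lambda>u. E' (E.vertex_fun u)" \<rho>
    by unfold_locales
  obtain k where k: "0 < k" "\<And>u. E' (E.vertex_fun u) = k * E (E.vertex_fun u)"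
    using proportional by blast
  have "E' u = k * E u" if "u \<in> rfun (sg_V0 q)" for u
    using k(2) rfun_triple[of u "q 1" "q 2" "q 3"] that E.vertices_distinct
    by (metis E.sg_V0_eq)
  then show ?thesis using k(1) by blast
qed

end
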